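(* Let $\Omega$ be a metrizable separable space and $c$ a Prokhorov capacity on $\mathcal{L}$. Let $\rho$ be a convex risk measure on $L^1(c)$. Then $\rho$ is continuous and $$\forall X\in L^1(c),\quad \rho(X)=\sup_{Q\in\mathcal{P}'}\big(E_Q[-X]-\alpha(Q)\big),\qquad \alpha(Q)=\sup_{X\in L^1(c)}\big(E_Q[-X]-\rho(X)\big),$$ where $\mathcal{P}'$ is the set of probability measures on $(\Omega,\mathcal{B}(\Omega))$ belonging to $L^1(c)^*$.
   Context: $\Omega$ is a metrizable separable space with Borel $\sigma$-algebra $\mathcal{B}(\Omega)$; $\mathcal{L}\subset\mathcal{C}_b(\Omega)$ is a linear subspace which is a vector lattice, contains the constants and generates the topology of $\Omega$. A capacity on $\mathcal{L}$ is a seminorm $c$ on $\mathcal{L}$ with $c(f)\le c(g)$ whenever $|f|\le|g|$, and $\inf_n c(f_n)=0$ for every sequence $f_n\in\mathcal{L}$ decreasing pointwise to $0$. It is extended to all real functions by $c(f)=\sup\{c(\varphi):\varphi\in\mathcal{L},0\le\varphi\le f\}$ for $f\ge 0$ lower semicontinuous and $c(g)=\inf\{c(f): f \text{ l.s.c.}, f\ge|g|\}$ in general. $\mathcal{L}^1(c)$ is the closure of $\mathcal{L}$ in $\{g: c(g)<\infty\}$ for $c$ and $L^1(c)$ is its quotient by $c$-null elements, a Banach space. $c$ is Prokhorov if for every $\varepsilon>0$ there is a compact $K$ with $c(f)\le\varepsilon$ for all $f\in\mathcal{L}$ with $|f|\le 1_{\Omega\setminus K}$. Order on $L^1(c)$: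 $X\ge0$ iff there are $f_n\in\mathcal{L}$, $f_n\ge0$, with $c(g-f_n)\to0$ for every representative $g$ of $X$; $X\le Y$ iff $Y-X\ge0$. A convex risk measure on $L^1(c)$ is a map $\rho:L^1(c)\to\mathbb{R}$ that is monotone ($X\le Y\Rightarrow\rho(X)\ge\rho(Y)$), convex and translation invariant ($\rho(X+a)=\rho(X)-a$). A Borel probability measure $Q$ belongs to $L^1(c)^*$ if $f\mapsto\int f\,dQ$ defines a continuous linear form on $L^1(c)$, whose value at $X$ is denoted $E_Q[X]$. *)

theory Defs
  imports "HOL-Analysis.Analysis" "HOL-Probability.Probability"
begin

text \<open>The space \<Omega> is the ambient type 'a with its topology (euclidean).
  Functions on \<Omega> are of type 'a \<Rightarrow> real. L is a set of such functions.\<close>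

definition Cb :: "('a::topological_space \<Rightarrow> real) set" where
  "Cb = {f. continuous_on UNIV f \<and> bounded (range f)}"

definition admissible_L :: "('a::topological_space \<Rightarrow> real) set \<Rightarrow> bool" where
  "admissible_L L \<longleftrightarrow>
     L \<subseteq> Cb \<and>
     (\<forall>f\<in>L. \<forall>g\<in>L. (\<lambda>x. f x + g x) \<in> L) \<and>
     (\<forall>a::real. \<forall>f\<in>L. (\<lambda>x. a * f x) \<in> L) \<and>
     (\<forall>f\<in>L. \<forall>g\<in>L. (\<lambda>x. max (f x) (g x)) \<in> L \<and> (\<lambda>x. min (f x) (g x)) \<in> L) \<and>
     (\<forall>a::real. (\<lambda>x. a) \<in> L) \<and>
     topology_generated_by {f -` U | f U. f \<in> L \<and> open U} = euclidean"

text \<open>A capacity on L (only the values of c on L matter).\<close>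
definition capacity_on :: "('a \<Rightarrow> real) set \<Rightarrow> (('a \<Rightarrow> real) \<Rightarrow> real) \<Rightarrow> bool" where
  "capacity_on L c \<longleftrightarrow>
     (\<forall>f\<in>L. \<forall>g\<in>L. c (\<lambda>x. f x + g x) \<le> c f + c g) \<and>
     (\<forall>a::real. \<forall>f\<in>L. c (\<lambda>x. a * f x) = \<bar>a\<bar> * c f) \<and>
     (\<forall>f\<in>L. \<forall>g\<in>L. (\<forall>x. \<bar>f x\<bar> \<le> \<bar>g x\<bar>) \<longrightarrow> c f \<le> c g) \<and>
     (\<forall>fs. (\<forall>n. fs n \<in> L) \<and> (\<forall>x. decseq (\<lambda>n. fs n x)) \<and> (\<forall>x. (\<lambda>n. fs n x) \<longlonglongrightarrow> 0)
          \<longrightarrow> (INF n. c (fs n)) = 0)"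

definition lsc_fun :: "('a::topological_space \<Rightarrow> ereal) \<Rightarrow> bool" where
  "lsc_fun f \<longleftrightarrow> (\<forall>t. open {x. t < f x})"

definition cap_lsc :: "('a \<Rightarrow> real) set \<Rightarrow> (('a \<Rightarrow> real) \<Rightarrow> real) \<Rightarrow> ('a \<Rightarrow> ereal) \<Rightarrow> ereal" where
  "cap_lsc L c f = (SUP \<phi>\<in>{\<phi>\<in>L. \<forall>x. 0 \<le> \<phi> x \<and> ereal (\<phi> x) \<le> f x}. ereal (c \<phi>))"

definition cap :: "('a::topological_space \<Rightarrow> real) set \<Rightarrow> (('a \<Rightarrow> real) \<Rightarrow> real) \<Rightarrow> ('a \<Rightarrow> real) \<Rightarrow> ereal" where
  "cap L c g = (INF f\<in>{f. lsc_fun f \<and> (\<forall>x. 0 \<le> f x) \<and> (\<forall>x. ereal \<bar>g x\<bar> \<le> f x)}. cap_lsc L c f)"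

definition prokhorov :: "('a::topological_space \<Rightarrow> real) set \<Rightarrow> (('a \<Rightarrow> real) \<Rightarrow> real) \<Rightarrow> bool" where
  "prokhorov L c \<longleftrightarrow> (\<forall>\<epsilon>>0. \<exists>K. compact K \<and>
      (\<forall>f\<in>L. (\<forall>x. \<bar>f x\<bar> \<le> indicator (- K) x) \<longrightarrow> c f \<le> \<epsilon>))"

text \<open>The space \<L>^1(c): closure of L in {g. c(g) < \<infinity>} for c. Elements of
  L^1(c) are represented by elements of this set modulo c-null differences.\<close>
definition L1 :: "('a::topological_space \<Rightarrow> real) set \<Rightarrow> (('a \<Rightarrow> real) \<Rightarrow> real) \<Rightarrow> ('a \<Rightarrow> real) set" where
  "L1 L c = {g. cap L c g < \<infinity> \<and>
      (\<exists>fs. (\<forall>n. fs n \<in> L) \<and> (\<lambda>n. cap L c (\<lambda>x. g x - fs n x)) \<longlonglongrightarrow> 0)}"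

definition L1_eq :: "('a::topological_space \<Rightarrow> real) set \<Rightarrow> (('a \<Rightarrow> real) \<Rightarrow> real) \<Rightarrow> ('a \<Rightarrow> real) \<Rightarrow> ('a \<Rightarrow> real) \<Rightarrow> bool" where
  "L1_eq L c g h \<longleftrightarrow> cap L c (\<lambda>x. g x - h x) = 0"

definition L1_nonneg :: "('a::topological_space \<Rightarrow> real) set \<Rightarrow> (('a \<Rightarrow> real) \<Rightarrow> real) \<Rightarrow> ('a \<Rightarrow> real) \<Rightarrow> bool" where
  "L1_nonneg L c g \<longleftrightarrow> (\<exists>fs. (\<forall>n. fs n \<in> L \<and> (\<forall>x. 0 \<le> fs n x)) \<and>
      (\<forall>g'\<in>L1 L c. L1_eq L c g' g \<longrightarrow> (\<lambda>n. cap L c (\<lambda>x. g' x - fs n x)) \<longlonglongrightarrow> 0))"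

definition L1_le :: "('a::topological_space \<Rightarrow> real) set \<Rightarrow> (('a \<Rightarrow> real) \<Rightarrow> real) \<Rightarrow> ('a \<Rightarrow> real) \<Rightarrow> ('a \<Rightarrow> real) \<Rightarrow> bool" where
  "L1_le L c g h \<longleftrightarrow> L1_nonneg L c (\<lambda>x. h x - g x)"

text \<open>A convex risk measure on L^1(c), given on representatives and required to be
  well defined on classes.\<close>
definition convex_risk_measure :: "('a::topological_space \<Rightarrow> real) set \<Rightarrow> (('a \<Rightarrow> real) \<Rightarrow> real) \<Rightarrow> (('a \<Rightarrow> real) \<Rightarrow> real) \<Rightarrow> bool" where
  "convex_risk_measure L c \<rho> \<longleftrightarrow>
     (\<forall>g\<in>L1 L c. \<forall>h\<in>L1 L c. L1_eq L c g h \<longrightarrow> \<rho> g = \<rho> h) \<and>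
     (\<forall>g\<in>L1 L c. \<forall>h\<in>L1 L c. L1_le L c g h \<longrightarrow> \<rho> g \<ge> \<rho> h) \<and>
     (\<forall>g\<in>L1 L c. \<forall>h\<in>L1 L c. \<forall>t::real. 0 \<le> t \<and> t \<le> 1 \<longrightarrow>
         \<rho> (\<lambda>x. t * g x + (1 - t) * h x) \<le> t * \<rho> g + (1 - t) * \<rho> h) \<and>
     (\<forall>g\<in>L1 L c. \<forall>a::real. \<rho> (\<lambda>x. g x + a) = \<rho> g - a)"

definition L1_continuous :: "('a::topological_space \<Rightarrow> real) set \<Rightarrow> (('a \<Rightarrow> real) \<Rightarrow> real) \<Rightarrow> (('a \<Rightarrow> real) \<Rightarrow> real) \<Rightarrow> bool" where
  "L1_continuous L c \<rho> \<longleftrightarrow>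
     (\<forall>g\<in>L1 L c. \<forall>\<epsilon>>0. \<exists>\<delta>>0. \<forall>h\<in>L1 L c.
        cap L c (\<lambda>x. h x - g x) < ereal \<delta> \<longrightarrow> \<bar>\<rho> h - \<rho> g\<bar> < \<epsilon>)"

text \<open>Q belongs to L^1(c)^*: f \<mapsto> \<integral> f dQ is c-continuous on the dense subspace L,
  hence extends (uniquely) to a continuous linear form on L^1(c).\<close>
definition in_L1_dual :: "('a::topological_space \<Rightarrow> real) set \<Rightarrow> (('a \<Rightarrow> real) \<Rightarrow> real) \<Rightarrow> 'a measure \<Rightarrow> bool" where
  "in_L1_dual L c Q \<longleftrightarrow> (\<exists>C. \<forall>f\<in>L. \<bar>integral\<^sup>L Q f\<bar> \<le> C * c f)"

text \<open>E_Q[X]: value at (the class of) g of the continuous extension.\<close>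
definition EQ :: "('a::topological_space \<Rightarrow> real) set \<Rightarrow> (('a \<Rightarrow> real) \<Rightarrow> real) \<Rightarrow> 'a measure \<Rightarrow> ('a \<Rightarrow> real) \<Rightarrow> real" where
  "EQ L c Q g = (THE y. \<forall>fs. (\<forall>n. fs n \<in> L) \<and> (\<lambda>n. cap L c (\<lambda>x. g x - fs n x)) \<longlonglongrightarrow> 0
                     \<longrightarrow> (\<lambda>n. integral\<^sup>L Q (fs n)) \<longlonglongrightarrow> y)"

definition Pdual :: "('a::topological_space \<Rightarrow> real) set \<Rightarrow> (('a \<Rightarrow> real) \<Rightarrow> real) \<Rightarrow> 'a measure set" where
  "Pdual L c = {Q. prob_space Q \<and> sets Q = sets borel \<and> in_L1_dual L c Q}"

definition penalty :: "('a::topological_space \<Rightarrow> real) set \<Rightarrow> (('a \<Rightarrow> real) \<Rightarrow> real) \<Rightarrow> (('a \<Rightarrow> real) \<Rightarrow> real) \<Rightarrow> 'a measure \<Rightarrow> ereal" where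
  "penalty L c \<rho> Q = (SUP g\<in>L1 L c. ereal (EQ L c Q (\<lambda>x. - g x) - \<rho> g))"

end

theory Submission
  imports Defs
begin

text \<open>Every nonnegative lower semicontinuous function is the supremum of an increasing sequence in \<open>L\<close>,
  so the downward continuity of \<open>c\<close> makes its extension countably subadditive and \<open>L1\<close> complete. By
  completeness a convex monotone functional is locally bounded above (a sequence of counterexamples
  with summable capacities would be dominated by its sum), hence continuous. By Hahn--Banach it has a
  subgradient at every point; monotonicity and translation invariance make the opposite of this
  subgradient a normalized positive linear form, which is a Daniell integral on \<open>L\<close> because it is
  bounded by a multiple of \<open>c\<close>. The Daniell--Stone measure of this form attains the supremum.\<close>

section \<open>Functions in the lattice and lower semicontinuity\<close>

text \<open>Two gaps shape the proof. The capacity is continuous only along sequences, while a lower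
  semicontinuous function is a priori a supremum of an uncountable family in \<open>L\<close>.
  Second countability closes this gap, and statements about the extension of \<open>c\<close> become
  comparisons of increasing sequences in \<open>L\<close>. Secondly, a continuous linear form could
  in general come from a merely finitely additive measure; here every form that is bounded by a
  multiple of \<open>c\<close> inherits the downward continuity of \<open>c\<close>, and this
  excludes it. Classes are never formed. All work is done on representatives, which are real valued
  everywhere; hence Hahn-Banach is proved for subspaces of functions, and divergent series need a
  value by convention. As \<open>cap\<close> is extended real, estimates take the form that
  \<open>cap L c h < ereal r\<close> implies a real inequality in \<open>r\<close>. One half of the
  duality is immediate from the definition of the penalty; only the attaining measure costs
  work.\<close>

lemma separable_metrizable_imp_second_countable:
  assumes "metrizable_space X" "separable_space X"
  shows "second_countable X"
proof -
  obtain M d where Md: "Metric_space M d" and X: "X = Metric_space.mtopology M d"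
    using assms(1) unfolding metrizable_space_def by blast
  interpret Metric_space M d by fact
  obtain D where D: "countable D" "D \<subseteq> M" "mtopology closure_of D = M"
    using assms(2) unfolding separable_space_def X by auto
  define \<B> where "\<B> = (\<lambda>(a, n). mball a (1 / real (Suc n))) ` (D \<times> UNIV)"
  have "\<exists>V\<in>\<B>. x \<in> V \<and> V \<subseteq> U" if U: "openin mtopology U" "x \<in> U" for U x
  proof -
    obtain r where r: "r > 0" "mball x r \<subseteq> U" and xM: "x \<in> M"
      using U unfolding openin_mtopology by blast
    \<comment> \<open>Half of \<open>r\<close>, because the ball around the dense point
      \<open>a\<close> reaches at most two such radii away from \<open>x\<close>.\<close>
    obtain n where n: "1 / real (Suc n) < r / 2"
      using r(1) nat_approx_posE[of "r / 2"] by auto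
    have "x \<in> mtopology closure_of D" using D(3) xM by simp
    then obtain a where a: "a \<in> D" "a \<in> mball x (1 / real (Suc n))"
      unfolding metric_closure_of by (smt (verit) mem_Collect_eq of_nat_0_less_iff zero_less_Suc zero_less_divide_1_iff)
    have aM: "a \<in> M" using a D by auto
    have "mball a (1 / real (Suc n)) \<subseteq> mball x r"
    proof
      fix y assume y: "y \<in> mball a (1 / real (Suc n))"
      have "d x y \<le> d x a + d a y" using y aM xM triangle by auto
      then show "y \<in> mball x r" using y a n xM by auto
    qed
    moreover have "x \<in> mball a (1 / real (Suc n))"
      using a(2) by (simp add: commute)
    moreover have "mball a (1 / real (Suc n)) \<in> \<B>"
      unfolding \<B>_def using a(1) by force
    ultimately show ?thesis using r(2) by blast
  qed
  moreover have "countable \<B>" unfolding \<B>_def using D(1) by simp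
  moreover have "openin mtopology V" if "V \<in> \<B>" for V
    using that unfolding \<B>_def by auto
  ultimately show ?thesis unfolding second_countable_def X by blast
qed

text \<open>Second countability is the form in which metrizability and separability enter: it makes
  sequences in \<open>L\<close> suffice.\<close>

locale lattice_capacity =
  fixes L :: "('a::topological_space \<Rightarrow> real) set"
    and c :: "('a \<Rightarrow> real) \<Rightarrow> real"
  assumes second_countable: "second_countable (euclidean :: 'a topology)"
    and admissible: "admissible_L L"
    and capacity: "capacity_on L c"
begin

section \<open>Elementary properties of the lattice and of the capacity on it\<close>

lemma L_continuous: "f \<in> L \<Longrightarrow> continuous_on UNIV f"
  and L_bounded: "f \<in> L \<Longrightarrow> bounded (range f)"
  and L_add: "f \<in> L \<Longrightarrow> g \<in> L \<Longrightarrow> (\<lambda>x. f x + g x) \<in> L"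
  and L_scale: "f \<in> L \<Longrightarrow> (\<lambda>x. a * f x) \<in> L"
  and L_max: "f \<in> L \<Longrightarrow> g \<in> L \<Longrightarrow> (\<lambda>x. max (f x) (g x)) \<in> L"
  and L_min: "f \<in> L \<Longrightarrow> g \<in> L \<Longrightarrow> (\<lambda>x. min (f x) (g x)) \<in> L"
  and L_const: "(\<lambda>x. a) \<in> L"
  and L_generates: "topology_generated_by {f -` U | f U. f \<in> L \<and> open U} = euclidean"
  using admissible unfolding admissible_L_def Cb_def by blast+

lemma L_minus: "f \<in> L \<Longrightarrow> (\<lambda>x. - f x) \<in> L"
  using L_scale[of f "-1"] by simp

lemma L_diff: "f \<in> L \<Longrightarrow> g \<in> L \<Longrightarrow> (\<lambda>x. f x - g x) \<in> L"
  using L_add[OF _ L_minus] by simp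

lemma L_abs: "f \<in> L \<Longrightarrow> (\<lambda>x. \<bar>f x\<bar>) \<in> L"
proof -
  assume "f \<in> L"
  moreover have "(\<lambda>x. \<bar>f x\<bar>) = (\<lambda>x. max (f x) (- f x))" by (auto simp: fun_eq_iff)
  ultimately show ?thesis using L_max[OF _ L_minus, of f f] by simp
qed

lemma L_sum: "(\<And>k. k \<in> A \<Longrightarrow> f k \<in> L) \<Longrightarrow> (\<lambda>x. \<Sum>k\<in>A. f k x) \<in> L"
proof (induction A rule: infinite_finite_induct)
  case (insert a A)
  then show ?case using L_add[of "f a" "\<lambda>x. \<Sum>k\<in>A. f k x"] by simp
qed (auto simp: L_const)

lemma c_add: "f \<in> L \<Longrightarrow> g \<in> L \<Longrightarrow> c (\<lambda>x. f x + g x) \<le> c f + c g"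
  and c_scale: "f \<in> L \<Longrightarrow> c (\<lambda>x. a * f x) = \<bar>a\<bar> * c f"
  and c_mono: "f \<in> L \<Longrightarrow> g \<in> L \<Longrightarrow> (\<And>x. \<bar>f x\<bar> \<le> \<bar>g x\<bar>) \<Longrightarrow> c f \<le> c g"
  and c_INF: "(\<And>n. fs n \<in> L) \<Longrightarrow> (\<And>x. decseq (\<lambda>n. fs n x)) \<Longrightarrow> (\<And>x. (\<lambda>n. fs n x) \<longlonglongrightarrow> 0) \<Longrightarrow>
    (INF n. c (fs n)) = 0"
  using capacity unfolding capacity_on_def by blast+

lemma c_zero: "c (\<lambda>x. 0) = 0"
  using c_scale[OF L_const, of 0 0] by simp

lemma c_nonneg: "f \<in> L \<Longrightarrow> 0 \<le> c f"
  using c_mono[OF L_const, of f 0] c_zero by simp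

lemma c_sum: "(\<And>k. k < (n::nat) \<Longrightarrow> f k \<in> L) \<Longrightarrow> c (\<lambda>x. \<Sum>k<n. f k x) \<le> (\<Sum>k<n. c (f k))"
proof (induction n)
  case (Suc n)
  have "c (\<lambda>x. (\<Sum>k<n. f k x) + f n x) \<le> c (\<lambda>x. \<Sum>k<n. f k x) + c (f n)"
    using Suc.prems by (intro c_add L_sum) auto
  then show ?case using Suc.IH Suc.prems by force
qed (simp add: c_zero)

lemma c_downward:
  assumes "\<And>n. fs n \<in> L" "\<And>x. decseq (\<lambda>n. fs n x)" "\<And>x. (\<lambda>n. fs n x) \<longlonglongrightarrow> 0" "e > 0"
  shows "\<exists>n. c (fs n) < e"
proof -
  have "bdd_below (range (\<lambda>n. c (fs n)))"
    using c_nonneg assms(1) by (intro bdd_belowI[of _ 0]) auto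
  then show ?thesis
    using c_INF[of fs, OF assms(1-3)] assms(4) cINF_less_iff[of UNIV "\<lambda>n. c (fs n)" e] by auto
qed

text \<open>Urysohn functions inside \<open>L\<close>, by induction on the generation of the open
  set: tents for subbasic sets, \<open>min\<close> for intersections, and a function for one member
  serves a union. Generating the topology is thus all that is asked of \<open>L\<close>.\<close>

lemma L_separates:
  assumes "open U" "x \<in> U"
  shows "\<exists>\<phi>\<in>L. (\<forall>y. 0 \<le> \<phi> y \<and> \<phi> y \<le> 1) \<and> \<phi> x = 1 \<and> (\<forall>y. y \<notin> U \<longrightarrow> \<phi> y = 0)"
proof -
  have "generate_topology_on {f -` U | f U. f \<in> L \<and> open U} U"
  proof (rule openin_topology_generated_by)
    show "openin (topology_generated_by {f -` U | f U. f \<in> L \<and> open U}) U"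
      by (subst L_generates) (rule open_openin[THEN iffD1, OF assms(1)])
  qed
  then show ?thesis using assms(2)
  proof (induction arbitrary: x)
    case (Int a b)
    then obtain \<phi> \<psi> where "\<phi> \<in> L" "\<forall>y. 0 \<le> \<phi> y \<and> \<phi> y \<le> 1" "\<phi> x = 1" "\<forall>y. y \<notin> a \<longrightarrow> \<phi> y = 0"
       "\<psi> \<in> L" "\<forall>y. 0 \<le> \<psi> y \<and> \<psi> y \<le> 1" "\<psi> x = 1" "\<forall>y. y \<notin> b \<longrightarrow> \<psi> y = 0"
      using Int.IH(1)[of x] Int.IH(2)[of x] Int.prems by blast
    then show ?case using L_min[of \<phi> \<psi>]
      by (intro bexI[of _ "\<lambda>y. min (\<phi> y) (\<psi> y)"]) (auto simp: min_def intro: antisym)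
  next
    case (UN K)
    then obtain k where k: "k \<in> K" "x \<in> k" by blast
    from UN.IH[OF this] show ?case using k by blast
  next
    case (Basis s)
    then obtain f V where f: "s = f -` V" "f \<in> L" "open V" by blast
    then obtain e where e: "e > 0" "ball (f x) e \<subseteq> V"
      using Basis.prems open_contains_ball by (metis vimage_eq)
    \<comment> \<open>A tent of height 1 at the value \<open>f x\<close>, vanishing where
      \<open>f\<close> leaves the \<open>e\<close>-ball around it.\<close>
    define \<phi> where "\<phi> = (\<lambda>y. max 0 (1 + (-1/e) * \<bar>f y + - f x\<bar>))"
    have "\<phi> \<in> L" unfolding \<phi>_def by (intro L_max L_const L_add L_scale L_abs f)
    moreover have "\<phi> y = 0" if "y \<notin> s" for y
    proof -
      have "f y \<notin> ball (f x) e" using that e f(1) by auto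
      then have "\<bar>f y + - f x\<bar> \<ge> e" by (auto simp: dist_real_def)
      then show ?thesis using e(1) unfolding \<phi>_def by (simp add: field_simps max_def)
    qed
    moreover have "0 \<le> \<phi> y \<and> \<phi> y \<le> 1" for y
      unfolding \<phi>_def using e(1) by (auto simp: max_def)
    moreover have "\<phi> x = 1" unfolding \<phi>_def by simp
    ultimately show ?case by blast
  qed auto
qed

text \<open>Countability is obtained by indexing with pairs of a rational level \<open>q\<close> and
  a basic open set \<open>W\<close>: for each pair, one function in \<open>L\<close> below
  \<open>h\<close> and at least \<open>q\<close> on \<open>W\<close> is selected whenever one
  exists. The supremum of this family is \<open>h\<close>, and running maxima make it
  increasing.\<close>

lemma lsc_approximation:
  fixes h :: "'a \<Rightarrow> ereal"
  assumes lsc: "lsc_fun h" and nonneg: "\<And>x. 0 \<le> h x"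
  shows "\<exists>\<phi>::nat \<Rightarrow> 'a \<Rightarrow> real. (\<forall>n. \<phi> n \<in> L) \<and> (\<forall>n x. 0 \<le> \<phi> n x) \<and> (\<forall>x. incseq (\<lambda>n. \<phi> n x)) \<and>
    (\<forall>x. (SUP n. ereal (\<phi> n x)) = h x)"
proof -
  obtain \<B> :: "'a set set" where \<B>: "countable \<B>" "\<And>V. V \<in> \<B> \<Longrightarrow> open V"
     "\<And>U x. open U \<Longrightarrow> x \<in> U \<Longrightarrow> \<exists>V\<in>\<B>. x \<in> V \<and> V \<subseteq> U"
    by (metis second_countable[unfolded second_countable_def] open_openin)
  define P where "P = (\<lambda>(q::rat, W::'a set) f. f \<in> L \<and> (\<forall>x. 0 \<le> f x \<and> ereal (f x) \<le> h x) \<and>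
      (\<forall>x\<in>W. of_rat q \<le> f x))"
  define I where "I = {p \<in> UNIV \<times> \<B>. \<exists>f. P p f}"
  have "countable I" unfolding I_def using \<B>(1) by (simp add: countable_rat countable_subset[of _ "UNIV \<times> \<B>"])
  \<comment> \<open>The zero function makes the family nonempty and settles the levels
    \<open>t < 0\<close>.\<close>
  define F where "F = insert (\<lambda>x. 0) ((\<lambda>p. SOME f. P p f) ` I)"
  have F: "countable F" "F \<noteq> {}" unfolding F_def using \<open>countable I\<close> by auto
  have Psome: "P p (SOME f. P p f)" if "p \<in> I" for p
    using that unfolding I_def by (metis (mono_tags, lifting) mem_Collect_eq someI_ex)
  have F_le: "f \<in> L \<and> (\<forall>x. 0 \<le> f x \<and> ereal (f x) \<le> h x)" if "f \<in> F" for f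
  proof (cases "f = (\<lambda>x. 0)")
    case True
    then show ?thesis using L_const nonneg by (simp flip: zero_ereal_def)
  next
    case False
    then have "f \<in> (\<lambda>p. SOME f. P p f) ` I" using that unfolding F_def by simp
    then obtain p where "p \<in> I" "f = (SOME f. P p f)" by (rule imageE) simp
    then have "P p f" using Psome by blast
    then show ?thesis unfolding P_def by (cases p) simp
  qed
  have F_ge: "\<exists>f\<in>F. t < ereal (f x)" if lt: "t < h x" for x t
  proof (cases "t < 0")
    case True
    then show ?thesis unfolding F_def
      by (intro bexI[of _ "\<lambda>x. 0"]) (simp_all flip: zero_ereal_def)
  next
    case False
    then obtain t' where t': "t = ereal t'" "t' \<ge> 0" using lt by (cases t) (auto simp: not_less)
    obtain s where s: "t < ereal s" "ereal s < h x" using ereal_dense2[OF lt] by blast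
    have "t' < s" using s t' by simp
    then obtain q where q: "t' < of_rat q" "of_rat q < s" using of_rat_dense by blast
    have q0: "(of_rat q :: real) > 0" using q t' by linarith
    define U where "U = {y. ereal (of_rat q) < h y}"
    have "ereal (of_rat q) < ereal s" using q by simp
    then have "x \<in> U" unfolding U_def using less_trans[OF _ s(2)] by blast
    moreover have oU: "open U" using lsc unfolding lsc_fun_def U_def by blast
    ultimately obtain \<phi> where \<phi>: "\<phi> \<in> L" "\<And>y. 0 \<le> \<phi> y \<and> \<phi> y \<le> 1" "\<phi> x = 1" "\<And>y. y \<notin> U \<Longrightarrow> \<phi> y = 0"
      using L_separates by metis
    \<comment> \<open>Doubling and truncating turns the peak of \<open>\<phi>\<close> at
      \<open>x\<close> into a plateau: \<open>f\<close> equals \<open>q\<close> on the open set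
      where \<open>\<phi>\<close> exceeds 1/2, so a whole basic set \<open>W\<close> fits under
      it.\<close>
    define f where "f = (\<lambda>y. of_rat q * min 1 (2 * \<phi> y))"
    have "f \<in> L" unfolding f_def by (intro L_scale L_min L_const \<phi>)
    have "open {y. 1/2 < \<phi> y}"
      using L_continuous[OF \<phi>(1)] by (intro open_Collect_less continuous_intros) auto
    moreover have "x \<in> {y. 1/2 < \<phi> y}" using \<phi>(3) by simp
    ultimately obtain W where W: "W \<in> \<B>" "x \<in> W" "W \<subseteq> {y. 1/2 < \<phi> y}"
      using \<B>(3) by blast
    have "ereal (f y) \<le> h y" for y
    proof (cases "y \<in> U")
      case True
      have "f y \<le> of_rat q" unfolding f_def using q0 by (simp add: mult_left_le)
      then have "ereal (f y) \<le> ereal (of_rat q)" by simp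
      also have "\<dots> < h y" using True unfolding U_def by simp
      finally show ?thesis by simp
    next
      case False
      then show ?thesis using \<phi>(4)[of y] nonneg[of y] unfolding f_def by (simp add: zero_ereal_def)
    qed
    moreover have "of_rat q \<le> f y" if "y \<in> W" for y
      using that W(3) unfolding f_def by (auto simp: min_def)
    moreover have "0 \<le> f y" for y unfolding f_def using q0 \<phi>(2)[of y] by simp
    ultimately have "P (q, W) f" unfolding P_def using \<open>f \<in> L\<close> by auto
    then have I: "(q, W) \<in> I" unfolding I_def using W by auto
    then have "P (q, W) (SOME f. P (q, W) f)" by (rule Psome)
    then have "of_rat q \<le> (SOME f. P (q, W) f) x" unfolding P_def using W(2) by simp
    moreover have "(SOME f. P (q, W) f) \<in> F" unfolding F_def using I by blast
    ultimately show ?thesis using q(1) unfolding t' by (intro bexI[of _ "SOME f. P (q, W) f"]) auto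
  qed
  define e where "e = from_nat_into F"
  have e: "e n \<in> F" for n unfolding e_def using F from_nat_into by blast
  have e_surj: "\<exists>n. e n = f" if "f \<in> F" for f
    unfolding e_def using from_nat_into_surj[OF F(1) that] .
  define \<phi> where "\<phi> = rec_nat (e 0) (\<lambda>n f x. max (f x) (e (Suc n) x))"
  have \<phi>0: "\<phi> 0 = e 0" and \<phi>S: "\<And>n. \<phi> (Suc n) = (\<lambda>x. max (\<phi> n x) (e (Suc n) x))"
    unfolding \<phi>_def by simp_all
  have \<phi>: "\<phi> n \<in> L \<and> (\<forall>x. 0 \<le> \<phi> n x \<and> ereal (\<phi> n x) \<le> h x \<and> e n x \<le> \<phi> n x)" for n
  proof (induction n)
    case 0
    then show ?case using F_le[OF e[of 0]] by (simp add: \<phi>0)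
  next
    case (Suc n)
    then show ?case using F_le[OF e[of "Suc n"]] L_max[of "\<phi> n" "e (Suc n)"] by (auto simp: \<phi>S max_def)
  qed
  have "incseq (\<lambda>n. \<phi> n x)" for x
    by (rule incseq_SucI) (simp add: \<phi>S)
  moreover have "(SUP n. ereal (\<phi> n x)) = h x" for x
  proof (rule antisym)
    show "(SUP n. ereal (\<phi> n x)) \<le> h x" using \<phi> by (auto intro: SUP_least)
    show "h x \<le> (SUP n. ereal (\<phi> n x))"
    proof (rule dense_le)
      fix t assume "t < h x"
      then obtain f where f: "f \<in> F" "t < ereal (f x)" using F_ge by blast
      then obtain n where "e n = f" using e_surj by blast
      then have "t < ereal (\<phi> n x)" using f(2) \<phi>[of n] by (auto intro: less_le_trans)
      then show "t \<le> (SUP n. ereal (\<phi> n x))" by (meson UNIV_I SUP_upper2 less_imp_le)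
    qed
  qed
  ultimately show ?thesis using \<phi> by blast
qed

end

section \<open>The extended capacity and its space of integrable functions\<close>

context lattice_capacity
begin

text \<open>A Dini argument with the capacity in place of uniform convergence: for a test function
  \<open>\<phi>\<close> below \<open>H\<close>, the positive parts of
  \<open>\<phi> - \<psi> n\<close> decrease pointwise to 0, so \<open>c \<phi>\<close> exceeds
  \<open>c (\<psi> n)\<close> by arbitrarily little. Hence any one increasing sequence in
  \<open>L\<close> controls the supremum over all test functions.\<close>

lemma cap_lsc_le_SUP:
  assumes L: "\<And>n. \<psi> n \<in> L" and nonneg: "\<And>n x. 0 \<le> \<psi> n x" and inc: "\<And>x. incseq (\<lambda>n. \<psi> n x)"
    and le: "\<And>x. H x \<le> (SUP n. ereal (\<psi> n x))" and bound: "\<And>n. ereal (c (\<psi> n)) \<le> S"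
  shows "cap_lsc L c H \<le> S"
  unfolding cap_lsc_def
proof (rule SUP_least)
  fix \<phi> assume "\<phi> \<in> {\<phi> \<in> L. \<forall>x. 0 \<le> \<phi> x \<and> ereal (\<phi> x) \<le> H x}"
  then have \<phi>: "\<phi> \<in> L" "\<And>x. 0 \<le> \<phi> x" "\<And>x. ereal (\<phi> x) \<le> H x" by auto
  define r where "r = (\<lambda>n x. max (\<phi> x - \<psi> n x) 0)"
  have r_L: "r n \<in> L" for n unfolding r_def by (intro L_max L_diff L_const \<phi> L)
  have r_dec: "decseq (\<lambda>n. r n x)" for x
    unfolding r_def decseq_def by (intro allI impI max.mono diff_left_mono incseqD[OF inc] order_refl)
  have r_lim: "(\<lambda>n. r n x) \<longlonglongrightarrow> 0" for x
  proof (rule LIMSEQ_I)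
    fix e :: real assume e: "e > 0"
    have "ereal (\<phi> x - e) < ereal (\<phi> x)" using e by simp
    also have "\<dots> \<le> (SUP n. ereal (\<psi> n x))" using \<phi>(3) le order_trans by blast
    finally obtain n where n: "\<phi> x - e < \<psi> n x" unfolding less_SUP_iff by auto
    have "norm (r m x - 0) < e" if "m \<ge> n" for m
    proof -
      have "\<psi> n x \<le> \<psi> m x" using inc[of x] that unfolding incseq_def by blast
      then show ?thesis using n e unfolding r_def by auto
    qed
    then show "\<exists>no. \<forall>n\<ge>no. norm (r n x - 0) < e" by blast
  qed
  show "ereal (c \<phi>) \<le> S"
  proof (rule ereal_le_epsilon2)
    fix e :: real assume "0 < e"
    then obtain n where n: "c (r n) < e" using c_downward[of r] r_L r_dec r_lim by blast
    have "c \<phi> \<le> c (\<lambda>x. r n x + \<psi> n x)"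
    proof (rule c_mono)
      show "\<bar>\<phi> x\<bar> \<le> \<bar>r n x + \<psi> n x\<bar>" for x
        unfolding r_def using \<phi>(2)[of x] nonneg[of n x] by auto
    qed (intro L_add r_L L \<phi>)+
    also have "\<dots> \<le> c (r n) + c (\<psi> n)" using r_L L by (rule c_add)
    finally have "c \<phi> \<le> c (\<psi> n) + e" using n by simp
    then have "ereal (c \<phi>) \<le> ereal (c (\<psi> n)) + ereal e" by simp
    also have "\<dots> \<le> S + ereal e" using bound by (rule add_right_mono)
    finally show "ereal (c \<phi>) \<le> S + ereal e" .
  qed
qed

section \<open>The extended capacity: consistency, subadditivity, homogeneity\<close>

lemma cap_lsc_upper: "\<phi> \<in> L \<Longrightarrow> (\<And>x. 0 \<le> \<phi> x) \<Longrightarrow> (\<And>x. ereal (\<phi> x) \<le> h x) \<Longrightarrow> ereal (c \<phi>) \<le> cap_lsc L c h"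
  unfolding cap_lsc_def by (rule SUP_upper) auto

lemma cap_le_cap_lsc:
  "lsc_fun h \<Longrightarrow> (\<And>x. 0 \<le> h x) \<Longrightarrow> (\<And>x. ereal \<bar>g x\<bar> \<le> h x) \<Longrightarrow> cap L c g \<le> cap_lsc L c h"
  unfolding cap_def by (rule INF_lower) auto

lemma cap_lessE:
  assumes "cap L c g < r"
  obtains h where "lsc_fun h" "\<And>x. 0 \<le> h x" "\<And>x. ereal \<bar>g x\<bar> \<le> h x" "cap_lsc L c h < r"
  using assms unfolding cap_def INF_less_iff by auto

lemma cap_lsc_nonneg: "(\<And>x. 0 \<le> h x) \<Longrightarrow> 0 \<le> cap_lsc L c h"
  using cap_lsc_upper[OF L_const, of 0 h] c_zero by (simp add: zero_ereal_def)

lemma cap_nonneg: "0 \<le> cap L c g"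
  unfolding cap_def by (rule INF_greatest) (auto intro: cap_lsc_nonneg)

lemma cap_mono:
  assumes "\<And>x. \<bar>f x\<bar> \<le> \<bar>g x\<bar>"
  shows "cap L c f \<le> cap L c g"
  unfolding cap_def
proof (rule INF_superset_mono, safe)
  fix h :: "'a \<Rightarrow> ereal" and x assume "\<forall>x. ereal \<bar>g x\<bar> \<le> h x"
  then have "ereal \<bar>g x\<bar> \<le> h x" by blast
  moreover have "ereal \<bar>f x\<bar> \<le> ereal \<bar>g x\<bar>" using assms by simp
  ultimately show "ereal \<bar>f x\<bar> \<le> h x" by (rule order_trans[rotated])
qed

lemma cap_cong: "(\<And>x. \<bar>f x\<bar> = \<bar>g x\<bar>) \<Longrightarrow> cap L c f = cap L c g"
  by (intro antisym cap_mono) simp_all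

lemma lsc_fun_SUP:
  assumes "\<And>n. \<psi> n \<in> L"
  shows "lsc_fun (\<lambda>x. SUP n::nat. ereal (\<psi> n x))"
  unfolding lsc_fun_def
proof
  fix t :: ereal
  have "{x. t < (SUP n. ereal (\<psi> n x))} = (\<Union>n. {x. t < ereal (\<psi> n x)})"
    by (auto simp: less_SUP_iff)
  moreover have "open {x. t < ereal (\<psi> n x)}" for n
    using L_continuous[OF assms] by (intro open_Collect_less continuous_intros) auto
  ultimately show "open {x. t < (SUP n. ereal (\<psi> n x))}" by auto
qed

text \<open>Since \<open>f\<close> is continuous, its absolute value is at the same time an
  admissible lower semicontinuous majorant and a test function below every other majorant.\<close>

lemma cap_L:
  assumes "f \<in> L"
  shows "cap L c f = ereal (c f)"
proof (rule antisym)
  have "lsc_fun (\<lambda>x. ereal \<bar>f x\<bar>)"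
    using lsc_fun_SUP[of "\<lambda>_ x. \<bar>f x\<bar>"] L_abs[OF assms] by simp
  then have "cap L c f \<le> cap_lsc L c (\<lambda>x. ereal \<bar>f x\<bar>)"
    by (rule cap_le_cap_lsc) auto
  also have "\<dots> \<le> ereal (c f)"
    unfolding cap_lsc_def using assms by (intro SUP_least) (auto intro!: c_mono)
  finally show "cap L c f \<le> ereal (c f)" .
  show "ereal (c f) \<le> cap L c f"
    unfolding cap_def
  proof (rule INF_greatest, safe)
    fix h :: "'a \<Rightarrow> ereal" assume h: "\<forall>x. ereal \<bar>f x\<bar> \<le> h x"
    have "ereal (c f) \<le> ereal (c (\<lambda>x. \<bar>f x\<bar>))"
      using assms L_abs[OF assms] by (auto intro: c_mono)
    also have "\<dots> \<le> cap_lsc L c h" using L_abs[OF assms] h by (intro cap_lsc_upper) auto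
    finally show "ereal (c f) \<le> cap_lsc L c h" .
  qed
qed

lemma cap_zero: "cap L c (\<lambda>x. 0) = 0"
  using cap_L[OF L_const] c_zero by (simp add: zero_ereal_def)

lemma cap_lsc_suminf:
  assumes lsc: "\<And>k. lsc_fun (h k)" and nonneg: "\<And>k x. 0 \<le> h k x"
  shows "lsc_fun (\<lambda>x. \<Sum>k. h k x)" "cap_lsc L c (\<lambda>x. \<Sum>k. h k x) \<le> (\<Sum>k. cap_lsc L c (h k))"
proof -
  have "\<exists>\<phi>::nat \<Rightarrow> 'a \<Rightarrow> real. (\<forall>n. \<phi> n \<in> L) \<and> (\<forall>n x. 0 \<le> \<phi> n x) \<and> (\<forall>x. incseq (\<lambda>n. \<phi> n x)) \<and>
    (\<forall>x. (SUP n. ereal (\<phi> n x)) = h k x)" for k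
    using lsc nonneg by (rule lsc_approximation)
  then obtain \<phi> :: "nat \<Rightarrow> nat \<Rightarrow> 'a \<Rightarrow> real" where \<phi>: "\<And>k n. \<phi> k n \<in> L" "\<And>k n x. 0 \<le> \<phi> k n x"
    "\<And>k x. incseq (\<lambda>n. \<phi> k n x)" "\<And>k x. (SUP n. ereal (\<phi> k n x)) = h k x"
    by metis
  \<comment> \<open>A diagonal sum: one index bounds both the number of terms and the stage of each
    approximation, so the sequence stays in \<open>L\<close>, increases, and has the full series as
    its supremum.\<close>
  define \<psi> where "\<psi> = (\<lambda>n x. \<Sum>k<n. \<phi> k n x)"
  have \<psi>_L: "\<psi> n \<in> L" for n unfolding \<psi>_def by (intro L_sum \<phi>)
  have \<psi>_nonneg: "0 \<le> \<psi> n x" for n x unfolding \<psi>_def by (intro sum_nonneg \<phi>)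
  have \<psi>_inc: "incseq (\<lambda>n. \<psi> n x)" for x
    unfolding incseq_def
  proof (intro allI impI)
    fix m n :: nat assume "m \<le> n"
    have "\<psi> m x \<le> (\<Sum>k<m. \<phi> k n x)"
      unfolding \<psi>_def using \<phi>(3) \<open>m \<le> n\<close> by (intro sum_mono) (auto simp: incseq_def)
    also have "\<dots> \<le> \<psi> n x"
      unfolding \<psi>_def using \<open>m \<le> n\<close> \<phi>(2) by (intro sum_mono2) auto
    finally show "\<psi> m x \<le> \<psi> n x" .
  qed
  have \<phi>_le: "ereal (\<phi> k n x) \<le> h k x" for k n x
    unfolding \<phi>(4)[symmetric] by (rule SUP_upper) simp
  have SUP_eq: "(\<Sum>k. h k x) = (SUP n. ereal (\<psi> n x))" for x
  proof (rule antisym)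
    show "(\<Sum>k. h k x) \<le> (SUP n. ereal (\<psi> n x))"
    proof (rule suminf_bound, rule allI)
      fix N
      have "(\<Sum>k<N. h k x) = (SUP n. \<Sum>k<N. ereal (\<phi> k n x))"
        unfolding \<phi>(4)[symmetric] using \<phi>(2,3)
        by (subst SUP_ereal_sum) (auto simp: incseq_def)
      also have "\<dots> \<le> (SUP n. ereal (\<psi> n x))"
      proof (rule SUP_least)
        fix n
        \<comment> \<open>The diagonal index \<open>max n N\<close> dominates both the stage
          \<open>n\<close> and the number \<open>N\<close> of terms.\<close>
        have "(\<Sum>k<N. \<phi> k n x) \<le> (\<Sum>k<N. \<phi> k (max n N) x)"
          using \<phi>(3) by (intro sum_mono) (auto simp: incseq_def)
        also have "\<dots> \<le> \<psi> (max n N) x"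
          unfolding \<psi>_def using \<phi>(2) by (intro sum_mono2) auto
        finally have "(\<Sum>k<N. ereal (\<phi> k n x)) \<le> ereal (\<psi> (max n N) x)" by simp
        then show "(\<Sum>k<N. ereal (\<phi> k n x)) \<le> (SUP n. ereal (\<psi> n x))"
          by (rule SUP_upper2[rotated]) simp
      qed
      finally show "(\<Sum>k<N. h k x) \<le> (SUP n. ereal (\<psi> n x))" .
    qed (rule nonneg)
    show "(SUP n. ereal (\<psi> n x)) \<le> (\<Sum>k. h k x)"
    proof (rule SUP_least)
      fix n
      have "ereal (\<psi> n x) = (\<Sum>k<n. ereal (\<phi> k n x))" unfolding \<psi>_def by simp
      also have "\<dots> \<le> (\<Sum>k<n. h k x)" by (intro sum_mono \<phi>_le)
      also have "\<dots> \<le> (\<Sum>k. h k x)" using nonneg by (rule suminf_upper)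
      finally show "ereal (\<psi> n x) \<le> (\<Sum>k. h k x)" .
    qed
  qed
  show "lsc_fun (\<lambda>x. \<Sum>k. h k x)" unfolding SUP_eq by (rule lsc_fun_SUP) (rule \<psi>_L)
  show "cap_lsc L c (\<lambda>x. \<Sum>k. h k x) \<le> (\<Sum>k. cap_lsc L c (h k))"
  proof (rule cap_lsc_le_SUP[OF \<psi>_L \<psi>_nonneg \<psi>_inc])
    show "(\<Sum>k. h k x) \<le> (SUP n. ereal (\<psi> n x))" for x by (simp add: SUP_eq)
    fix n
    have "ereal (c (\<psi> n)) \<le> (\<Sum>k<n. ereal (c (\<phi> k n)))"
      unfolding \<psi>_def using \<phi>(1) by (simp add: c_sum)
    also have "\<dots> \<le> (\<Sum>k<n. cap_lsc L c (h k))"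
      using \<phi>(1,2) \<phi>_le by (intro sum_mono cap_lsc_upper) auto
    also have "\<dots> \<le> (\<Sum>k. cap_lsc L c (h k))"
      using nonneg by (intro suminf_upper cap_lsc_nonneg)
    finally show "ereal (c (\<psi> n)) \<le> (\<Sum>k. cap_lsc L c (h k))" .
  qed
qed

text \<open>Almost optimal lower semicontinuous majorants of the \<open>f k\<close> add up to one of
  \<open>g\<close>; their excesses \<open>e * (1/2) ^ Suc k\<close> sum to \<open>e\<close>.\<close>

lemma cap_countably_subadditive:
  assumes le: "\<And>x. ereal \<bar>g x\<bar> \<le> (\<Sum>k. ereal \<bar>f k x\<bar>)"
  shows "cap L c g \<le> (\<Sum>k. cap L c (f k))"
proof (cases "\<forall>k. cap L c (f k) < \<infinity>")
  \<comment> \<open>Almost optimal majorants exist only for finite capacities; one infinite term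
    makes the right-hand side infinite.\<close>
  case False
  then obtain k where "cap L c (f k) = \<infinity>" by auto
  moreover have "cap L c (f k) \<le> (\<Sum>k. cap L c (f k))"
    using suminf_upper[of "\<lambda>k. cap L c (f k)" "Suc k"] sum_nonneg[of "{..<k}" "\<lambda>k. cap L c (f k)"] cap_nonneg
    by (simp) (meson add_increasing order_refl order_trans)
  ultimately show ?thesis by simp
next
  case True
  show ?thesis
  proof (rule ereal_le_epsilon2)
    fix e :: real assume e: "0 < e"
    have "\<exists>h. lsc_fun h \<and> (\<forall>x. 0 \<le> h x) \<and> (\<forall>x. ereal \<bar>f k x\<bar> \<le> h x) \<and>
        cap_lsc L c h < cap L c (f k) + ereal (e * (1/2) ^ Suc k)" for k
    proof -
      have "cap L c (f k) < cap L c (f k) + ereal (e * (1/2) ^ Suc k)"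
        using True cap_nonneg[of "f k"] e by (cases "cap L c (f k)") auto
      from cap_lessE[OF this] show ?thesis by metis
    qed
    then obtain h where h: "\<And>k. lsc_fun (h k)" "\<And>k x. 0 \<le> h k x" "\<And>k x. ereal \<bar>f k x\<bar> \<le> h k x"
        "\<And>k. cap_lsc L c (h k) < cap L c (f k) + ereal (e * (1/2) ^ Suc k)"
      by metis
    have "cap L c g \<le> cap_lsc L c (\<lambda>x. \<Sum>k. h k x)"
    proof (rule cap_le_cap_lsc)
      show "lsc_fun (\<lambda>x. \<Sum>k. h k x)" using h(1,2) by (rule cap_lsc_suminf)
      show "0 \<le> (\<Sum>k. h k x)" for x using h(2) by (simp add: suminf_0_le)
      have "(\<Sum>k. ereal \<bar>f k x\<bar>) \<le> (\<Sum>k. h k x)" for x using h(3) by (intro suminf_le_pos) auto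
      then show "ereal \<bar>g x\<bar> \<le> (\<Sum>k. h k x)" for x using le order_trans by blast
    qed
    also have "\<dots> \<le> (\<Sum>k. cap_lsc L c (h k))" using h(1,2) by (rule cap_lsc_suminf)
    also have "\<dots> \<le> (\<Sum>k. cap L c (f k) + ereal (e * (1/2) ^ Suc k))"
      using h by (intro suminf_le_pos) (auto intro: cap_lsc_nonneg less_imp_le)
    also have "\<dots> = (\<Sum>k. cap L c (f k)) + (\<Sum>k. ereal (e * (1/2) ^ Suc k))"
      using e cap_nonneg by (intro suminf_add_ereal) auto
    also have "(\<lambda>k. e * (1/2) ^ Suc k) sums (e * 1)"
      using power_half_series by (rule sums_mult)
    then have "(\<Sum>k. ereal (e * (1/2) ^ Suc k)) = ereal e"
      using sums_ereal sums_unique by (metis mult.right_neutral)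
    finally show "cap L c g \<le> (\<Sum>k. cap L c (f k)) + ereal e" .
  qed
qed

lemma cap_subadditive:
  assumes "\<And>x. \<bar>g x\<bar> \<le> \<bar>f x\<bar> + \<bar>h x\<bar>"
  shows "cap L c g \<le> cap L c f + cap L c h"
proof -
  \<comment> \<open>The finite case follows from the countable one by padding with zero functions,
    whose capacity is 0.\<close>
  define F where "F = (\<lambda>k::nat. if k = 0 then f else if k = 1 then h else (\<lambda>x. 0))"
  have "cap L c g \<le> (\<Sum>k. cap L c (F k))"
  proof (rule cap_countably_subadditive)
    fix x
    have "(\<Sum>k. ereal \<bar>F k x\<bar>) = (\<Sum>k\<in>{0, 1}. ereal \<bar>F k x\<bar>)"
      by (rule suminf_finite) (auto simp: F_def zero_ereal_def)
    then show "ereal \<bar>g x\<bar> \<le> (\<Sum>k. ereal \<bar>F k x\<bar>)" using assms by (simp add: F_def)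
  qed
  also have "\<dots> = (\<Sum>k\<in>{0, 1}. cap L c (F k))"
    by (rule suminf_finite) (auto simp: F_def cap_zero)
  finally show ?thesis by (simp add: F_def)
qed

lemma cap_triangle: "cap L c (\<lambda>x. f x - h x) \<le> cap L c (\<lambda>x. f x - g x) + cap L c (\<lambda>x. g x - h x)"
  by (rule cap_subadditive) simp

lemma cap_commute: "cap L c (\<lambda>x. f x - g x) = cap L c (\<lambda>x. g x - f x)"
  by (rule cap_cong) simp

text \<open>Homogeneity in the form needed for rescaling balls. The strict bound selects a majorant
  of finite capacity; its approximating sequence is multiplied by \<open>\<bar>a\<bar>\<close>
  inside \<open>L\<close>, where \<open>c\<close> scales exactly.\<close>

lemma cap_scale_less:
  assumes "cap L c g < ereal r" "a \<noteq> 0"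
  shows "cap L c (\<lambda>x. a * g x) < ereal (\<bar>a\<bar> * r)"
proof -
  obtain h where h: "lsc_fun h" "\<And>x. 0 \<le> h x" "\<And>x. ereal \<bar>g x\<bar> \<le> h x" "cap_lsc L c h < ereal r"
    using cap_lessE[OF assms(1)] by metis
  have a: "\<bar>a\<bar> > 0" using assms(2) by simp
  obtain s where s: "cap_lsc L c h = ereal s" "s < r"
    using h(4) cap_lsc_nonneg[of h] h(2) by (cases "cap_lsc L c h") auto
  obtain \<phi> :: "nat \<Rightarrow> 'a \<Rightarrow> real" where \<phi>: "\<And>n. \<phi> n \<in> L" "\<And>n x. 0 \<le> \<phi> n x" "\<And>x. incseq (\<lambda>n. \<phi> n x)"
    "\<And>x. (SUP n. ereal (\<phi> n x)) = h x"
    using lsc_approximation[OF h(1,2)] by metis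
  define \<psi> where "\<psi> = (\<lambda>n x. \<bar>a\<bar> * \<phi> n x)"
  have \<psi>: "\<psi> n \<in> L" "0 \<le> \<psi> n x" "incseq (\<lambda>n. \<psi> n x)" for n x
    unfolding \<psi>_def using \<phi> by (auto intro: L_scale simp: incseq_def mult_left_mono)
  define H where "H = (\<lambda>x. SUP n. ereal (\<psi> n x))"
  have H: "H x = ereal \<bar>a\<bar> * h x" for x
    unfolding H_def \<psi>_def \<phi>(4)[symmetric] using \<phi>(2) a
    by (simp add: SUP_ereal_mult_left flip: times_ereal.simps(1))
  have "cap L c (\<lambda>x. a * g x) \<le> cap_lsc L c H"
  proof (rule cap_le_cap_lsc)
    show "lsc_fun H" unfolding H_def using \<psi> by (intro lsc_fun_SUP)
    show "0 \<le> H x" for x using H h(2) a by simp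
    show "ereal \<bar>a * g x\<bar> \<le> H x" for x
      using ereal_mult_left_mono[OF h(3)[of x], of "ereal \<bar>a\<bar>"] by (simp add: H abs_mult)
  qed
  also have "\<dots> \<le> ereal (\<bar>a\<bar> * s)"
  proof (rule cap_lsc_le_SUP)
    show "\<psi> n \<in> L" "0 \<le> \<psi> n x" "incseq (\<lambda>n. \<psi> n x)" for n x by fact+
    show "H x \<le> (SUP n. ereal (\<psi> n x))" for x unfolding H_def by simp
    fix n
    have "ereal (\<phi> n x) \<le> h x" for x unfolding \<phi>(4)[symmetric] by (rule SUP_upper) simp
    then have "ereal (c (\<phi> n)) \<le> ereal s" unfolding s(1)[symmetric] using \<phi> by (intro cap_lsc_upper)
    then show "ereal (c (\<psi> n)) \<le> ereal (\<bar>a\<bar> * s)"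
      unfolding \<psi>_def using a by (simp add: c_scale[OF \<phi>(1)] mult_left_mono)
  qed
  also have "\<dots> < ereal (\<bar>a\<bar> * r)" using s a by simp
  finally show ?thesis .
qed

section \<open>The space L^1(c): a vector lattice closed under limits, and its order\<close>

lemma L1_iff: "g \<in> L1 L c \<longleftrightarrow> (\<forall>e>0. \<exists>f\<in>L. cap L c (\<lambda>x. g x - f x) < ereal e)"
proof
  assume "g \<in> L1 L c"
  then obtain fs where fs: "\<And>n. fs n \<in> L" "(\<lambda>n. cap L c (\<lambda>x. g x - fs n x)) \<longlonglongrightarrow> 0"
    unfolding L1_def by auto
  show "\<forall>e>0. \<exists>f\<in>L. cap L c (\<lambda>x. g x - f x) < ereal e"
  proof (intro allI impI)
    fix e :: real assume "e > 0"
    then have "\<forall>\<^sub>F n in sequentially. cap L c (\<lambda>x. g x - fs n x) < ereal e"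
      using fs(2) by (intro order_tendstoD(2)) auto
    then show "\<exists>f\<in>L. cap L c (\<lambda>x. g x - f x) < ereal e"
      using fs(1) eventually_happens'[OF sequentially_bot] by blast
  qed
next
  assume *: "\<forall>e>0. \<exists>f\<in>L. cap L c (\<lambda>x. g x - f x) < ereal e"
  then have "\<exists>f\<in>L. cap L c (\<lambda>x. g x - f x) < ereal (1 / real (Suc n))" for n by simp
  then obtain fs where fs: "\<And>n. fs n \<in> L" "\<And>n. cap L c (\<lambda>x. g x - fs n x) < ereal (1 / real (Suc n))"
    by metis
  have lim: "(\<lambda>n. ereal (1 / real (Suc n))) \<longlonglongrightarrow> 0"
    using LIMSEQ_inverse_real_of_nat by (simp add: zero_ereal_def inverse_eq_divide)
  have "(\<lambda>n. cap L c (\<lambda>x. g x - fs n x)) \<longlonglongrightarrow> 0"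
    using fs(2) cap_nonneg by (intro tendsto_sandwich[OF _ _ tendsto_const lim] always_eventually) (auto intro: less_imp_le)
  moreover have "cap L c g < \<infinity>"
  proof -
    \<comment> \<open>A single approximant of finite capacity at finite distance already makes the
      capacity of \<open>g\<close> finite.\<close>
    have "cap L c g \<le> cap L c (\<lambda>x. g x - fs 0 x) + cap L c (fs 0)"
      by (rule cap_subadditive) auto
    also have "\<dots> < \<infinity>" using fs(2)[of 0] cap_L[OF fs(1)] by auto
    finally show ?thesis .
  qed
  ultimately show "g \<in> L1 L c" unfolding L1_def using fs by auto
qed

lemma L1_L: "f \<in> L \<Longrightarrow> f \<in> L1 L c"
  unfolding L1_iff by (auto intro!: bexI[of _ f] simp: cap_zero)

lemma L1_closed:
  assumes "\<And>e::real. e > 0 \<Longrightarrow> \<exists>f\<in>L1 L c. cap L c (\<lambda>x. g x - f x) < ereal e"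
  shows "g \<in> L1 L c"
  unfolding L1_iff
proof (intro allI impI)
  fix e :: real assume e: "e > 0"
  obtain f where f: "f \<in> L1 L c" "cap L c (\<lambda>x. g x - f x) < ereal (e/2)" using assms[of "e/2"] e by auto
  obtain k where k: "k \<in> L" "cap L c (\<lambda>x. f x - k x) < ereal (e/2)"
    using f(1) e unfolding L1_iff by (meson half_gt_zero)
  have "cap L c (\<lambda>x. g x - k x) \<le> cap L c (\<lambda>x. g x - f x) + cap L c (\<lambda>x. f x - k x)" by (rule cap_triangle)
  also have "\<dots> < ereal (e/2) + ereal (e/2)" using f k by (intro ereal_add_strict_mono2)
  finally show "\<exists>f\<in>L. cap L c (\<lambda>x. g x - f x) < ereal e" using k by auto
qed

lemma L1_add:
  assumes "f \<in> L1 L c" "g \<in> L1 L c"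
  shows "(\<lambda>x. f x + g x) \<in> L1 L c"
  unfolding L1_iff
proof (intro allI impI)
  fix e :: real assume e: "e > 0"
  obtain k where k: "k \<in> L" "cap L c (\<lambda>x. f x - k x) < ereal (e/2)"
    using assms(1) e unfolding L1_iff by (meson half_gt_zero)
  obtain l where l: "l \<in> L" "cap L c (\<lambda>x. g x - l x) < ereal (e/2)"
    using assms(2) e unfolding L1_iff by (meson half_gt_zero)
  have "cap L c (\<lambda>x. f x + g x - (k x + l x)) \<le> cap L c (\<lambda>x. f x - k x) + cap L c (\<lambda>x. g x - l x)"
    by (rule cap_subadditive) simp
  also have "\<dots> < ereal (e/2) + ereal (e/2)" using l k by (intro ereal_add_strict_mono2)
  finally show "\<exists>h\<in>L. cap L c (\<lambda>x. f x + g x - h x) < ereal e"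
    using L_add[OF k(1) l(1)] by auto
qed

lemma L1_scale:
  assumes "f \<in> L1 L c"
  shows "(\<lambda>x. a * f x) \<in> L1 L c"
proof (cases "a = 0")
  case True
  then show ?thesis using L1_L[OF L_const, of 0] by simp
next
  case False
  show ?thesis
    unfolding L1_iff
  proof (intro allI impI)
    fix e :: real assume e: "e > 0"
    obtain k where k: "k \<in> L" "cap L c (\<lambda>x. f x - k x) < ereal (e / \<bar>a\<bar>)"
      using assms(1) e False unfolding L1_iff by (meson divide_pos_pos zero_less_abs_iff)
    have "cap L c (\<lambda>x. a * (f x - k x)) < ereal (\<bar>a\<bar> * (e / \<bar>a\<bar>))"
      using k(2) False by (rule cap_scale_less)
    then show "\<exists>h\<in>L. cap L c (\<lambda>x. a * f x - h x) < ereal e"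
      using L_scale[OF k(1), of a] False by (auto simp: right_diff_distrib)
  qed
qed

lemma L1_abs:
  assumes "f \<in> L1 L c"
  shows "(\<lambda>x. \<bar>f x\<bar>) \<in> L1 L c"
  unfolding L1_iff
proof (intro allI impI)
  fix e :: real assume e: "e > 0"
  obtain k where k: "k \<in> L" "cap L c (\<lambda>x. f x - k x) < ereal e"
    using assms(1) e unfolding L1_iff by blast
  have "cap L c (\<lambda>x. \<bar>f x\<bar> - \<bar>k x\<bar>) \<le> cap L c (\<lambda>x. f x - k x)"
    by (rule cap_mono) linarith
  then show "\<exists>h\<in>L. cap L c (\<lambda>x. \<bar>f x\<bar> - h x) < ereal e"
    using L_abs[OF k(1)] k(2) by (auto intro: le_less_trans)
qed

lemma L1_minus: "f \<in> L1 L c \<Longrightarrow> (\<lambda>x. - f x) \<in> L1 L c"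
  using L1_scale[of f "-1"] by simp

lemma L1_diff: "f \<in> L1 L c \<Longrightarrow> g \<in> L1 L c \<Longrightarrow> (\<lambda>x. f x - g x) \<in> L1 L c"
  using L1_add[OF _ L1_minus] by simp

lemma L1_sum: "(\<And>k. k \<in> A \<Longrightarrow> f k \<in> L1 L c) \<Longrightarrow> (\<lambda>x. \<Sum>k\<in>A. f k x) \<in> L1 L c"
proof (induction A rule: infinite_finite_induct)
  case (insert a A)
  then show ?case using L1_add[of "f a" "\<lambda>x. \<Sum>k\<in>A. f k x"] by simp
qed (auto simp: L1_L[OF L_const])

text \<open>The positive parts of approximants of \<open>g\<close> are nonnegative approximants:
  replacing \<open>fs n\<close> by its positive part costs at most the capacity of the negative part
  of \<open>g\<close>. A change of representative adds a term of capacity 0, so one sequence serves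
  all of them.\<close>

lemma L1_nonnegI:
  assumes g: "g \<in> L1 L c" and neg: "cap L c (\<lambda>x. max (- g x) 0) = 0"
  shows "L1_nonneg L c g"
proof -
  obtain fs where fs: "\<And>n. fs n \<in> L" "(\<lambda>n. cap L c (\<lambda>x. g x - fs n x)) \<longlonglongrightarrow> 0"
    using g unfolding L1_def by auto
  define ps where "ps = (\<lambda>n x. max (fs n x) 0)"
  have ps: "ps n \<in> L" "0 \<le> ps n x" for n x unfolding ps_def by (auto intro: L_max L_const fs)
  have "(\<lambda>n. cap L c (\<lambda>x. g' x - ps n x)) \<longlonglongrightarrow> 0" if "L1_eq L c g' g" for g'
  proof (rule tendsto_sandwich[OF _ _ tendsto_const fs(2)]; intro always_eventually allI)
    fix n
    have "cap L c (\<lambda>x. g' x - ps n x) \<le> cap L c (\<lambda>x. g' x - g x) + cap L c (\<lambda>x. g x - ps n x)"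
      by (rule cap_triangle)
    also have "cap L c (\<lambda>x. g x - ps n x) \<le> cap L c (\<lambda>x. max (- g x) 0) + cap L c (\<lambda>x. g x - fs n x)"
      by (rule cap_subadditive) (auto simp: ps_def)
    finally show "cap L c (\<lambda>x. g' x - ps n x) \<le> cap L c (\<lambda>x. g x - fs n x)"
      using that neg unfolding L1_eq_def by (simp add: add_mono)
  qed (rule cap_nonneg)
  then show ?thesis unfolding L1_nonneg_def using ps by (intro exI[of _ ps]) auto
qed

lemma L1_nonneg_pointwise: "g \<in> L1 L c \<Longrightarrow> (\<And>x. 0 \<le> g x) \<Longrightarrow> L1_nonneg L c g"
  by (rule L1_nonnegI) (auto simp: max_def cap_zero intro!: trans[OF cap_cong cap_zero])

text \<open>Where the series diverges, the junk value of \<open>suminf\<close> is harmless: by countable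
  subadditivity the divergence set is null for the capacity.\<close>
lemma L1_dominating:
  assumes f: "\<And>k. f k \<in> L1 L c" and cap: "\<And>k. cap L c (f k) \<le> ereal ((1/2) ^ k)"
  shows "\<exists>g\<in>L1 L c. \<forall>k. L1_nonneg L c (\<lambda>x. f k x + g x)"
proof -
  define g where "g = (\<lambda>x. if summable (\<lambda>k. \<bar>f k x\<bar>) then \<Sum>k. \<bar>f k x\<bar> else 0)"
  \<comment> \<open>Used twice: for the distance of \<open>g\<close> to its partial sums, and for
    the negative part of \<open>f n + g\<close>. Both lie below every tail of the series that is
    considered, because at a point of divergence each tail is infinite.\<close>
  have tail: "cap L c h \<le> ereal (2 * (1/2) ^ m)"
    if h: "\<And>x. ereal \<bar>h x\<bar> \<le> (\<Sum>k. ereal \<bar>f (k + m) x\<bar>)" for h m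
  proof -
    have "cap L c h \<le> (\<Sum>k. cap L c (f (k + m)))"
      using h by (rule cap_countably_subadditive)
    also have "\<dots> \<le> (\<Sum>k. ereal ((1/2) ^ (k + m)))"
      using cap cap_nonneg by (intro suminf_le_pos) auto
    also have "(\<lambda>k. (1/2) ^ m * (1/2::real) ^ k) sums ((1/2) ^ m * (1 / (1 - 1/2)))"
      by (intro sums_mult geometric_sums) simp
    then have "(\<lambda>k. (1/2::real) ^ (k + m)) sums (2 * (1/2) ^ m)"
      by (simp add: power_add mult.commute)
    then have "(\<Sum>k. ereal ((1/2) ^ (k + m))) = ereal (2 * (1/2) ^ m)"
      using sums_ereal sums_unique by metis
    finally show ?thesis .
  qed
  have diverge: "(\<Sum>k. ereal \<bar>f (k + m) x\<bar>) = \<infinity>" if "\<not> summable (\<lambda>k. \<bar>f k x\<bar>)" for m x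
  proof (rule ccontr)
    assume "(\<Sum>k. ereal \<bar>f (k + m) x\<bar>) \<noteq> \<infinity>"
    then have "summable (\<lambda>k. \<bar>f (k + m) x\<bar>)" by (intro summable_ereal) auto
    then show False using that summable_iff_shift by blast
  qed
  have converge: "(\<Sum>k. ereal \<bar>f (k + m) x\<bar>) = ereal (g x - (\<Sum>k<m. \<bar>f k x\<bar>))"
    if "summable (\<lambda>k. \<bar>f k x\<bar>)" for m x
  proof -
    have "(\<lambda>k. \<bar>f (k + m) x\<bar>) sums (g x - (\<Sum>k<m. \<bar>f k x\<bar>))"
      using that unfolding g_def by (intro sums_split_initial_segment) (simp add: summable_sums)
    then show ?thesis using sums_ereal sums_unique by metis
  qed
  have small: "\<exists>m. 2 * (1/2) ^ m < (e::real)" if "e > 0" for e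
    using real_arch_pow_inv[of "e/2" "1/2"] that by (auto simp: mult.commute)
  have gL1: "g \<in> L1 L c"
  proof (rule L1_closed)
    fix e :: real assume "e > 0"
    then obtain m where m: "2 * (1/2) ^ m < e" using small by blast
    have "cap L c (\<lambda>x. g x - (\<Sum>k<m. \<bar>f k x\<bar>)) \<le> ereal (2 * (1/2) ^ m)"
    proof (rule tail)
      fix x
      show "ereal \<bar>g x - (\<Sum>k<m. \<bar>f k x\<bar>)\<bar> \<le> (\<Sum>k. ereal \<bar>f (k + m) x\<bar>)"
      proof (cases "summable (\<lambda>k. \<bar>f k x\<bar>)")
        case True
        then have "(\<Sum>k<m. \<bar>f k x\<bar>) \<le> g x" unfolding g_def by (simp add: sum_le_suminf)
        then show ?thesis using converge[OF True, of m] by simp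
      qed (simp add: diverge)
    qed
    also have "\<dots> < ereal e" using m by simp
    finally have "cap L c (\<lambda>x. g x - (\<Sum>k<m. \<bar>f k x\<bar>)) < ereal e" .
    then show "\<exists>h\<in>L1 L c. cap L c (\<lambda>x. g x - h x) < ereal e"
      using L1_sum[of "{..<m}" "\<lambda>k x. \<bar>f k x\<bar>", OF L1_abs[OF f]]
      by (intro bexI[of _ "\<lambda>x. \<Sum>k<m. \<bar>f k x\<bar>"])
  qed
  have "L1_nonneg L c (\<lambda>x. f n x + g x)" for n
  proof (rule L1_nonnegI)
    show "(\<lambda>x. f n x + g x) \<in> L1 L c" using f gL1 by (rule L1_add)
    have "cap L c (\<lambda>x. max (- (f n x + g x)) 0) \<le> ereal e" if "e > 0" for e :: real
    proof -
      obtain m where m: "2 * (1/2) ^ m < e" using small \<open>e > 0\<close> by blast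
      have "cap L c (\<lambda>x. max (- (f n x + g x)) 0) \<le> ereal (2 * (1/2) ^ m)"
      proof (rule tail)
        fix x
        show "ereal \<bar>max (- (f n x + g x)) 0\<bar> \<le> (\<Sum>k. ereal \<bar>f (k + m) x\<bar>)"
        proof (cases "summable (\<lambda>k. \<bar>f k x\<bar>)")
          case True
          \<comment> \<open>At a point of convergence \<open>g\<close> dominates each single term,
            so the negative part lives on the divergence set only.\<close>
          have "(\<Sum>k\<in>{n}. \<bar>f k x\<bar>) \<le> g x" using True unfolding g_def by (simp only: if_True) (rule sum_le_suminf, auto)
          then have "max (- (f n x + g x)) 0 = 0" by simp
          moreover have "0 \<le> (\<Sum>k. ereal \<bar>f (k + m) x\<bar>)" by (intro suminf_0_le) auto
          ultimately show ?thesis by (simp add: zero_ereal_def)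
        qed (simp add: diverge)
      qed
      also have "\<dots> \<le> ereal e" using m by simp
      finally show ?thesis .
    qed
    then have "cap L c (\<lambda>x. max (- (f n x + g x)) 0) \<le> 0"
      by (rule ereal_le_epsilon2[of _ 0, unfolded add_0])
    then show "cap L c (\<lambda>x. max (- (f n x + g x)) 0) = 0" using cap_nonneg by (rule antisym)
  qed
  then show ?thesis using gL1 by blast
qed

end

section \<open>Convex functionals dominate linear forms\<close>

text \<open>A set of functions instead of a type of vectors, because \<open>L1 L c\<close> consists
  of representatives that are not divided by null functions.\<close>

definition function_subspace :: "('b \<Rightarrow> real) set \<Rightarrow> bool" where
  "function_subspace V \<longleftrightarrow> V \<noteq> {} \<and> (\<forall>f\<in>V. \<forall>g\<in>V. (\<lambda>x. f x + g x) \<in> V) \<and> (\<forall>a. \<forall>f\<in>V. (\<lambda>x. a * f x) \<in> V)"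

text \<open>Homogeneity is asked only as an inequality for \<open>a > 0\<close>, which infima
  inherit easily; the inequality for \<open>1/a\<close> gives back equality in
  \<open>sublinear_on_scale\<close>.\<close>

definition sublinear_on :: "('b \<Rightarrow> real) set \<Rightarrow> (('b \<Rightarrow> real) \<Rightarrow> real) \<Rightarrow> bool" where
  "sublinear_on V p \<longleftrightarrow> (\<forall>f\<in>V. \<forall>g\<in>V. p (\<lambda>x. f x + g x) \<le> p f + p g) \<and>
    (\<forall>f\<in>V. \<forall>a>0. p (\<lambda>x. a * f x) \<le> a * p f)"

definition linear_form_on :: "('b \<Rightarrow> real) set \<Rightarrow> (('b \<Rightarrow> real) \<Rightarrow> real) \<Rightarrow> bool" where
  "linear_form_on V l \<longleftrightarrow> (\<forall>f\<in>V. \<forall>g\<in>V. l (\<lambda>x. f x + g x) = l f + l g) \<and>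
    (\<forall>f\<in>V. \<forall>a. l (\<lambda>x. a * f x) = a * l f)"

lemma function_subspaceD:
  assumes "function_subspace V"
  shows "f \<in> V \<Longrightarrow> g \<in> V \<Longrightarrow> (\<lambda>x. f x + g x) \<in> V" "f \<in> V \<Longrightarrow> (\<lambda>x. a * f x) \<in> V"
    "(\<lambda>x. 0) \<in> V" "f \<in> V \<Longrightarrow> (\<lambda>x. - f x) \<in> V"
proof -
  show add: "f \<in> V \<Longrightarrow> g \<in> V \<Longrightarrow> (\<lambda>x. f x + g x) \<in> V"
    and scale: "f \<in> V \<Longrightarrow> (\<lambda>x. a * f x) \<in> V" for f g a
    using assms unfolding function_subspace_def by blast+
  obtain f0 where "f0 \<in> V" using assms unfolding function_subspace_def by blast
  then show "(\<lambda>x. 0) \<in> V" using scale[of f0 0] by simp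
  show "f \<in> V \<Longrightarrow> (\<lambda>x. - f x) \<in> V" using scale[of f "-1"] by simp
qed

text \<open>The common pattern of three infima used below: over a chain, over shifts in a direction,
  and over difference quotients. Each time some index \<open>r\<close> combines the indices
  \<open>s\<close> and \<open>t\<close> of the two summands.\<close>

lemma sublinear_on_INF:
  fixes F :: "('b \<Rightarrow> real) \<Rightarrow> 'i \<Rightarrow> real"
  assumes "I \<noteq> {}" and bdd: "\<And>f. f \<in> V \<Longrightarrow> bdd_below (F f ` I)" and V: "function_subspace V"
    and add: "\<And>f g s t. f \<in> V \<Longrightarrow> g \<in> V \<Longrightarrow> s \<in> I \<Longrightarrow> t \<in> I \<Longrightarrow> \<exists>r\<in>I. F (\<lambda>x. f x + g x) r \<le> F f s + F g t"
    and scale: "\<And>f t a. f \<in> V \<Longrightarrow> t \<in> I \<Longrightarrow> a > 0 \<Longrightarrow> \<exists>r\<in>I. F (\<lambda>x. a * f x) r \<le> a * F f t"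
  shows "sublinear_on V (\<lambda>f. INF t\<in>I. F f t)"
  unfolding sublinear_on_def
proof (intro conjI ballI allI impI)
  fix f g assume f: "f \<in> V" and g: "g \<in> V"
  let ?m = "INF r\<in>I. F (\<lambda>x. f x + g x) r"
  have "?m \<le> F f s + F g t" if "s \<in> I" "t \<in> I" for s t
  proof -
    obtain r where "r \<in> I" "F (\<lambda>x. f x + g x) r \<le> F f s + F g t"
      using add[OF f g \<open>s \<in> I\<close> \<open>t \<in> I\<close>] by blast
    then show ?thesis
      using cINF_lower[OF bdd[OF function_subspaceD(1)[OF V f g]]] order_trans by blast
  qed
  then have "?m - F g t \<le> (INF s\<in>I. F f s)" if "t \<in> I" for t
    using \<open>I \<noteq> {}\<close> that by (intro cINF_greatest) (auto simp: algebra_simps)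
  then have "?m - (INF s\<in>I. F f s) \<le> (INF t\<in>I. F g t)"
    using \<open>I \<noteq> {}\<close> by (intro cINF_greatest) (auto simp: algebra_simps)
  then show "?m \<le> (INF s\<in>I. F f s) + (INF t\<in>I. F g t)" by simp
next
  fix f and a :: real assume f: "f \<in> V" and a: "0 < a"
  let ?m = "INF r\<in>I. F (\<lambda>x. a * f x) r"
  have "?m / a \<le> F f t" if "t \<in> I" for t
  proof -
    obtain r where "r \<in> I" "F (\<lambda>x. a * f x) r \<le> a * F f t"
      using scale[OF f \<open>t \<in> I\<close> a] by blast
    then have "?m \<le> a * F f t"
      using cINF_lower[OF bdd[OF function_subspaceD(2)[OF V f]]] order_trans by blast
    then show ?thesis using a by (simp add: divide_le_eq mult.commute)
  qed
  then have "?m / a \<le> (INF t\<in>I. F f t)" using \<open>I \<noteq> {}\<close> by (intro cINF_greatest)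
  then show "?m \<le> a * (INF t\<in>I. F f t)" using a by (simp add: divide_le_eq mult.commute)
qed

lemma sublinear_on_scale:
  assumes V: "function_subspace V" and p: "sublinear_on V p" and f: "f \<in> V" and a: "a \<ge> 0"
  shows "p (\<lambda>x. a * f x) = a * p f"
proof -
  have le: "p (\<lambda>x. a * f x) \<le> a * p f" if "f \<in> V" "a > 0" for f a
    using p that unfolding sublinear_on_def by blast
  show ?thesis
  proof (cases "a = 0")
    case True
    \<comment> \<open>The factor 2 gives a nonnegative value and the factor 1/2 a nonpositive
      one.\<close>
    have "p (\<lambda>x. 0) = 0"
      using le[OF function_subspaceD(3)[OF V], of 2] le[OF function_subspaceD(3)[OF V], of "1/2"] by simp
    then show ?thesis using True by simp
  next
    case False
    then have "a > 0" using a by simp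
    then have "p f \<le> (1/a) * p (\<lambda>x. a * f x)"
      using le[OF function_subspaceD(2)[OF V f], of "1/a" a] by simp
    then have "a * p f \<le> p (\<lambda>x. a * f x)" using \<open>a > 0\<close> by (simp add: le_divide_eq mult.commute)
    then show ?thesis using le[OF f \<open>a > 0\<close>] by simp
  qed
qed

lemma sublinear_on_add: "sublinear_on V p \<Longrightarrow> f \<in> V \<Longrightarrow> g \<in> V \<Longrightarrow> p (\<lambda>x. f x + g x) \<le> p f + p g"
  unfolding sublinear_on_def by blast

lemma sublinear_on_lower:
  assumes V: "function_subspace V" and p: "sublinear_on V p" and f: "f \<in> V" and g: "g \<in> V"
  shows "p g - p (\<lambda>x. - f x) \<le> p (\<lambda>x. f x + g x)"
  using sublinear_on_add[OF p function_subspaceD(4)[OF V f] function_subspaceD(1)[OF V f g]] by simp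

lemma sublinear_on_lower':
  assumes V: "function_subspace V" and p: "sublinear_on V p" and f: "f \<in> V"
  shows "- p (\<lambda>x. - f x) \<le> p f"
  using sublinear_on_lower[OF V p f function_subspaceD(3)[OF V]]
    sublinear_on_scale[OF V p f, of 0] by simp

text \<open>A minimal sublinear functional is linear, and Zorn's lemma yields a minimal one below \<^term>\<open>p\<close>.\<close>
theorem sublinear_dominates_linear_form:
  assumes V: "function_subspace V" and p: "sublinear_on V p"
  shows "\<exists>l. linear_form_on V l \<and> (\<forall>f\<in>V. l f \<le> p f)"
proof -
  \<comment> \<open>The value 0 outside \<open>V\<close> makes the pointwise order antisymmetric, so
    minimality can be expressed by equality of functionals.\<close>
  define S where "S = {q. sublinear_on V q \<and> (\<forall>f\<in>V. q f \<le> p f) \<and> (\<forall>f. f \<notin> V \<longrightarrow> q f = 0)}"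
  \<comment> \<open>The order is reversed, since Zorn's lemma delivers maximal elements.\<close>
  define below where "below = (\<lambda>q r :: ('a \<Rightarrow> real) \<Rightarrow> real. \<forall>f. r f \<le> q f)"
  \<comment> \<open>A lower bound common to all members of \<open>S\<close>; it makes the infimum
    over a chain finite.\<close>
  have lower: "- p (\<lambda>x. - f x) \<le> q f" if "q \<in> S" "f \<in> V" for q f
  proof -
    have "- q (\<lambda>x. - f x) \<le> q f" using that unfolding S_def by (intro sublinear_on_lower'[OF V]) auto
    moreover have "q (\<lambda>x. - f x) \<le> p (\<lambda>x. - f x)"
      using that function_subspaceD(4)[OF V] unfolding S_def by blast
    ultimately show ?thesis by simp
  qed
  have "\<exists>m\<in>S. \<forall>a\<in>S. below m a \<longrightarrow> a = m"
  proof (rule predicate_Zorn)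
    show "partial_order_on S (relation_of below S)"
      by (rule partial_order_on_relation_ofI) (auto simp: below_def intro: order_trans antisym intro!: ext)
    fix C assume C: "C \<in> Chains (relation_of below S)"
    then have CS: "C \<subseteq> S" and chain: "\<And>q r. q \<in> C \<Longrightarrow> r \<in> C \<Longrightarrow> below q r \<or> below r q"
      unfolding Chains_def relation_of_def by auto
    show "\<exists>u\<in>S. \<forall>a\<in>C. below a u"
    proof (cases "C = {}")
      case True
      have "(\<lambda>f. if f \<in> V then p f else 0) \<in> S"
        using p function_subspaceD[OF V] unfolding S_def sublinear_on_def by auto
      then show ?thesis using True by blast
    next
      case False
      define u where "u = (\<lambda>f. INF q\<in>C. q f)"
      have bdd: "bdd_below ((\<lambda>q. q f) ` C)" for f
      proof (cases "f \<in> V")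
        case True
        then show ?thesis using lower CS by (intro bdd_belowI2) blast
      next
        case False
        then show ?thesis using CS unfolding S_def by (intro bdd_belowI2[of _ 0]) auto
      qed
      have sub: "sublinear_on V q" if "q \<in> C" for q using that CS unfolding S_def by blast
      have u_le: "u f \<le> q f" if "q \<in> C" for q f
        unfolding u_def using bdd that by (rule cINF_lower)
      have "sublinear_on V u"
        unfolding u_def
      proof (rule sublinear_on_INF[OF False bdd V])
        fix f g q r assume fg: "f \<in> V" "g \<in> V" and qr: "q \<in> C" "r \<in> C"
        \<comment> \<open>The smaller of the two functionals serves both summands.\<close>
        from chain[OF qr] show "\<exists>s\<in>C. s (\<lambda>x. f x + g x) \<le> q f + r g"
        proof
          assume "below q r"
          then have "r f \<le> q f" unfolding below_def by blast
          then show ?thesis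
            using sublinear_on_add[OF sub[OF qr(2)] fg] qr(2) by (intro bexI[of _ r]) auto
        next
          assume "below r q"
          then have "q g \<le> r g" unfolding below_def by blast
          then show ?thesis
            using sublinear_on_add[OF sub[OF qr(1)] fg] qr(1) by (intro bexI[of _ q]) auto
        qed
      next
        fix f q and a :: real assume "f \<in> V" "q \<in> C" "0 < a"
        then show "\<exists>r\<in>C. r (\<lambda>x. a * f x) \<le> a * q f"
          using sublinear_on_scale[OF V sub, of q f a] by (intro bexI[of _ q]) auto
      qed
      moreover have "u f \<le> p f" if "f \<in> V" for f
      proof -
        obtain q where q: "q \<in> C" using False by blast
        then have "q f \<le> p f" using CS that unfolding S_def by blast
        then show ?thesis using u_le[OF q, of f] by simp
      qed
      moreover have "u f = 0" if "f \<notin> V" for f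
      proof -
        have "(\<lambda>q. q f) ` C = {0}" using that False CS unfolding S_def by force
        then show ?thesis unfolding u_def by simp
      qed
      ultimately have "u \<in> S" unfolding S_def by blast
      then show ?thesis using u_le unfolding below_def by blast
    qed
  qed
  then obtain l where lS: "l \<in> S" and minimal: "\<And>q. q \<in> S \<Longrightarrow> (\<And>f. q f \<le> l f) \<Longrightarrow> q = l"
    unfolding below_def by blast
  have l: "sublinear_on V l" and l_le: "\<And>f. f \<in> V \<Longrightarrow> l f \<le> p f"
    and l_out: "\<And>f. f \<notin> V \<Longrightarrow> l f = 0"
    using lS unfolding S_def by auto
  have additive: "l (\<lambda>x. f x + g x) = l f + l g" if f: "f \<in> V" and g: "g \<in> V" for f g
  proof -
    \<comment> \<open>The infimum over \<open>t\<close> lowers \<open>l\<close> in the direction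
      \<open>g\<close>. The value \<open>t = 0\<close> puts it below \<open>l\<close>, so minimality
      forces equality; the value \<open>t = 1\<close> then reads
      \<open>l f + l g \<le> l (f + g)\<close>.\<close>
    define F where "F = (\<lambda>f t. l (\<lambda>x. f x + t * g x) - t * l g)"
    define q where "q = (\<lambda>f. if f \<in> V then INF t\<in>{0..}. F f t else 0)"
    have bdd: "bdd_below (F f ` {0..})" if "f \<in> V" for f
    proof (rule bdd_belowI2)
      fix t :: real assume "t \<in> {0..}"
      then show "- l (\<lambda>x. - f x) \<le> F f t"
        unfolding F_def using sublinear_on_lower[OF V l that function_subspaceD(2)[OF V g, of t]]
          sublinear_on_scale[OF V l g, of t] by simp
    qed
    have "sublinear_on V (\<lambda>f. INF t\<in>{0..}. F f t)"
    proof (rule sublinear_on_INF[OF _ bdd V])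
      fix f h and s t :: real assume fh: "f \<in> V" "h \<in> V" and st: "s \<in> {0..}" "t \<in> {0..}"
      have "l (\<lambda>x. (f x + s * g x) + (h x + t * g x)) \<le> l (\<lambda>x. f x + s * g x) + l (\<lambda>x. h x + t * g x)"
        by (intro sublinear_on_add[OF l] function_subspaceD[OF V] fh g)
      moreover have "(\<lambda>x. (f x + s * g x) + (h x + t * g x)) = (\<lambda>x. f x + h x + (s + t) * g x)"
        by (simp add: algebra_simps)
      ultimately have "F (\<lambda>x. f x + h x) (s + t) \<le> F f s + F h t"
        unfolding F_def by (simp add: algebra_simps)
      then show "\<exists>r\<in>{0..}. F (\<lambda>x. f x + h x) r \<le> F f s + F h t"
        using st by (intro bexI[of _ "s + t"]) auto
    next
      fix f and t a :: real assume f: "f \<in> V" and t: "t \<in> {0..}" and a: "0 < a"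
      have "l (\<lambda>x. a * (f x + t * g x)) = a * l (\<lambda>x. f x + t * g x)"
        using a by (intro sublinear_on_scale[OF V l] function_subspaceD[OF V] f g) auto
      then have "F (\<lambda>x. a * f x) (a * t) \<le> a * F f t"
        unfolding F_def by (simp add: algebra_simps)
      then show "\<exists>r\<in>{0..}. F (\<lambda>x. a * f x) r \<le> a * F f t"
        using t a by (intro bexI[of _ "a * t"]) auto
    qed auto
    then have "sublinear_on V q"
      using function_subspaceD[OF V] unfolding q_def sublinear_on_def by simp
    moreover have q_le: "q f \<le> l f" for f
    proof (cases "f \<in> V")
      case True
      have "q f \<le> F f 0" using True bdd[OF True] unfolding q_def by (auto intro: cINF_lower)
      then show ?thesis unfolding F_def by simp
    qed (simp add: q_def l_out)
    moreover have "q f \<le> p f" if "f \<in> V" for f using q_le[of f] l_le[OF that] by simp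
    ultimately have "q \<in> S" unfolding S_def q_def by simp
    then have "q = l" using q_le by (rule minimal)
    moreover have "q f \<le> F f 1" using f bdd[OF f] unfolding q_def by (auto intro: cINF_lower)
    ultimately have "l f + l g \<le> l (\<lambda>x. f x + g x)" unfolding F_def by simp
    then show ?thesis using sublinear_on_add[OF l f g] by simp
  qed
  have neg: "l (\<lambda>x. - f x) = - l f" if "f \<in> V" for f
    using additive[OF that function_subspaceD(4)[OF V that]] sublinear_on_scale[OF V l that, of 0] by simp
  have "l (\<lambda>x. a * f x) = a * l f" if f: "f \<in> V" for f a
  proof (cases "a \<ge> 0")
    case False
    then have "l (\<lambda>x. - a * f x) = - a * l f" by (intro sublinear_on_scale[OF V l f]) simp
    then show ?thesis using neg[OF function_subspaceD(2)[OF V f], of a] by simp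
  qed (rule sublinear_on_scale[OF V l f])
  then show ?thesis using additive l_le unfolding linear_form_on_def by blast
qed

text \<open>The one-sided directional derivative at the origin is a sublinear minorant of \<^term>\<open>\<phi>\<close>.\<close>
theorem convex_dominates_linear_form:
  assumes V: "function_subspace V"
    and convex: "\<And>f g t. f \<in> V \<Longrightarrow> g \<in> V \<Longrightarrow> 0 \<le> t \<Longrightarrow> t \<le> 1 \<Longrightarrow>
      \<phi> (\<lambda>x. t * f x + (1 - t) * g x) \<le> t * \<phi> f + (1 - t) * \<phi> g"
    and zero: "\<phi> (\<lambda>x. 0) = 0"
  shows "\<exists>l. linear_form_on V l \<and> (\<forall>f\<in>V. l f \<le> \<phi> f)"
proof -
  define F where "F = (\<lambda>f t. \<phi> (\<lambda>x. t * f x) / t)"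
  have bdd: "bdd_below (F f ` {0<..})" if f: "f \<in> V" for f
  proof (rule bdd_belowI2)
    fix t :: real assume "t \<in> {0<..}"
    then have t: "t > 0" by simp
    \<comment> \<open>The weight for which the convex combination of \<open>t * f\<close> and
      \<open>- f\<close> is 0; this bounds all difference quotients below by
      \<open>- \<phi> (- f)\<close>.\<close>
    define u where "u = 1 / (1 + t)"
    have u: "0 \<le> u" "u \<le> 1" "u * t = 1 - u" "u > 0" using t unfolding u_def by (auto simp: field_simps)
    have "\<phi> (\<lambda>x. u * (t * f x) + (1 - u) * (- f x)) \<le> u * \<phi> (\<lambda>x. t * f x) + (1 - u) * \<phi> (\<lambda>x. - f x)"
      using u by (intro convex function_subspaceD[OF V] f)
    moreover have "(\<lambda>x. u * (t * f x) + (1 - u) * (- f x)) = (\<lambda>x. 0)"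
      using u(3) by (simp flip: mult.assoc)
    ultimately have "0 \<le> u * (\<phi> (\<lambda>x. t * f x) + t * \<phi> (\<lambda>x. - f x))"
      using zero u(3) by (simp add: distrib_left flip: mult.assoc)
    then have "0 \<le> \<phi> (\<lambda>x. t * f x) + t * \<phi> (\<lambda>x. - f x)"
      using u(4) by (simp add: zero_le_mult_iff)
    then show "- \<phi> (\<lambda>x. - f x) \<le> F f t"
      unfolding F_def using t by (simp add: le_divide_eq algebra_simps)
  qed
  have "sublinear_on V (\<lambda>f. INF t\<in>{0<..}. F f t)"
  proof (rule sublinear_on_INF[OF _ bdd V])
    fix f g and s t :: real assume fg: "f \<in> V" "g \<in> V" and "s \<in> {0<..}" "t \<in> {0<..}"
    then have st: "s > 0" "t > 0" by auto
    \<comment> \<open>Chosen so that \<open>u * s = (1 - u) * t\<close>; with this common value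
      \<open>r\<close>, the combination of \<open>s * f\<close> and \<open>t * g\<close> is exactly
      \<open>r * (f + g)\<close>.\<close>
    define u where "u = t / (s + t)"
    define r where "r = u * s"
    have u: "0 \<le> u" "u \<le> 1" "r = (1 - u) * t" "r > 0" "u > 0" "1 - u > 0"
      using st unfolding r_def u_def by (auto simp: field_simps)
    have "\<phi> (\<lambda>x. u * (s * f x) + (1 - u) * (t * g x)) \<le> u * \<phi> (\<lambda>x. s * f x) + (1 - u) * \<phi> (\<lambda>x. t * g x)"
      using u by (intro convex function_subspaceD[OF V] fg)
    moreover have "(\<lambda>x. u * (s * f x) + (1 - u) * (t * g x)) = (\<lambda>x. r * (f x + g x))"
      unfolding distrib_left using u(3) by (simp add: r_def flip: mult.assoc)
    ultimately have "F (\<lambda>x. f x + g x) r \<le> (u * \<phi> (\<lambda>x. s * f x) + (1 - u) * \<phi> (\<lambda>x. t * g x)) / r"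
      unfolding F_def using u(4) by (simp add: divide_right_mono)
    also have "\<dots> = u * \<phi> (\<lambda>x. s * f x) / (u * s) + (1 - u) * \<phi> (\<lambda>x. t * g x) / ((1 - u) * t)"
      using u(3) by (simp add: add_divide_distrib r_def)
    also have "\<dots> = F f s + F g t"
      unfolding F_def using u(5,6) by simp
    finally show "\<exists>r\<in>{0<..}. F (\<lambda>x. f x + g x) r \<le> F f s + F g t" using u(4) by auto
  next
    fix f and t a :: real assume f: "f \<in> V" and t: "t \<in> {0<..}" and a: "0 < a"
    have "F (\<lambda>x. a * f x) (t / a) \<le> a * F f t"
      unfolding F_def using a t by (simp add: field_simps)
    then show "\<exists>r\<in>{0<..}. F (\<lambda>x. a * f x) r \<le> a * F f t" using t a by auto
  qed auto
  from sublinear_dominates_linear_form[OF V this]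
  obtain l where l: "linear_form_on V l" "\<And>f. f \<in> V \<Longrightarrow> l f \<le> (INF t\<in>{0<..}. F f t)" by blast
  have "l f \<le> \<phi> f" if "f \<in> V" for f
  proof -
    have "(INF t\<in>{0<..}. F f t) \<le> F f 1" using bdd[OF that] by (rule cINF_lower) simp
    then show ?thesis using l(2)[OF that] unfolding F_def by simp
  qed
  then show ?thesis using l(1) by blast
qed

section \<open>The Daniell--Stone representation\<close>

text \<open>Half-open at the top, so that regions meeting along a graph are disjoint and the fibres
  are intervals stable under intersection and cutting.\<close>

definition region :: "('b \<Rightarrow> real) \<Rightarrow> ('b \<Rightarrow> real) \<Rightarrow> ('b \<times> real) set" where
  "region f g = {(x, t). f x \<le> t \<and> t < g x}"

lemma region_fibre: "{t. (x, t) \<in> region f g} = {f x..<g x}"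
  unfolding region_def by auto

text \<open>The outer \<open>max\<close> in the upper bound leaves the set unchanged but keeps the
  bounding pair ordered over points where the fibres do not meet.\<close>

lemma region_Int:
  "region f g \<inter> region f' g' =
    region (\<lambda>x. max (f x) (f' x)) (\<lambda>x. max (max (f x) (f' x)) (min (g x) (g' x)))"
  unfolding region_def by auto

text \<open>The pieces are what lies below \<open>f'\<close> and what lies above \<open>g'\<close>,
  with ordered bounds; they are disjoint as soon as \<open>f' \<le> g'\<close>.\<close>

lemma region_Diff:
  "region f g - region f' g' =
    region f (\<lambda>x. max (f x) (min (g x) (f' x))) \<union> region (\<lambda>x. min (g x) (max (f x) (g' x))) g"
  unfolding region_def by auto

context lattice_capacity
begin

lemma L_open_greater: "f \<in> L \<Longrightarrow> open {x. t < f x}"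
  using L_continuous by (intro open_Collect_less continuous_intros) auto

lemma semiring_regions:
  "semiring_of_sets UNIV {region f g | f g. f \<in> L \<and> g \<in> L \<and> (\<forall>x. f x \<le> g x)}" (is "semiring_of_sets _ ?S")
proof
  show "?S \<subseteq> Pow UNIV" by simp
  have "{} = region (\<lambda>x::'a. 0) (\<lambda>x. 0)" unfolding region_def by auto
  then show "{} \<in> ?S" using L_const by blast
next
  fix a b assume "a \<in> ?S" "b \<in> ?S"
  then obtain f g f' g' where a: "a = region f g" "f \<in> L" "g \<in> L" "\<And>x. f x \<le> g x"
    and b: "b = region f' g'" "f' \<in> L" "g' \<in> L" "\<And>x. f' x \<le> g' x" by auto
  show "a \<inter> b \<in> ?S"
    unfolding a(1) b(1) region_Int
    using L_max[OF a(2) b(2)] L_max[OF L_max[OF a(2) b(2)] L_min[OF a(3) b(3)]]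
    by (intro CollectI exI[of _ "\<lambda>x. max (f x) (f' x)"]
      exI[of _ "\<lambda>x. max (max (f x) (f' x)) (min (g x) (g' x))"]) auto
  let ?A = "region f (\<lambda>x. max (f x) (min (g x) (f' x)))"
  let ?B = "region (\<lambda>x. min (g x) (max (f x) (g' x))) g"
  have "?A \<in> ?S" using a(2) L_max[OF a(2) L_min[OF a(3) b(2)]]
    by (intro CollectI exI[of _ f] exI[of _ "\<lambda>x. max (f x) (min (g x) (f' x))"]) auto
  moreover have "?B \<in> ?S" using a(3) L_min[OF a(3) L_max[OF a(2) b(3)]]
    by (intro CollectI exI[of _ g] exI[of _ "\<lambda>x. min (g x) (max (f x) (g' x))"]) auto
  moreover have "?A \<inter> ?B = {}"
  proof (rule equals0I)
    fix p assume "p \<in> ?A \<inter> ?B"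
    then have "snd p < f' (fst p)" "g' (fst p) \<le> snd p" unfolding region_def by auto
    then show False using b(4)[of "fst p"] by simp
  qed
  then have "disjoint {?A, ?B}" unfolding disjoint_def by blast
  moreover have "a - b = \<Union>{?A, ?B}" unfolding a(1) b(1) region_Diff by simp
  ultimately show "\<exists>C\<subseteq>?S. finite C \<and> disjoint C \<and> a - b = \<Union> C"
    by (intro exI[of _ "{?A, ?B}"] conjI) auto
qed

lemma lsc_indicator:
  assumes "open U"
  shows "lsc_fun (indicator U :: 'a \<Rightarrow> ereal)"
  unfolding lsc_fun_def
proof
  fix t :: ereal
  consider "t < 0" | "0 \<le> t" "t < 1" | "1 \<le> t" by fastforce
  then have "{x. t < (indicator U x :: ereal)} \<in> {UNIV, U, {}}"
  proof cases
    case 1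
    then have "{x. t < (indicator U x :: ereal)} = UNIV"
      using less_trans[OF 1, of 1] by (simp add: indicator_def)
    then show ?thesis by simp
  next
    case 2
    then have "{x. t < (indicator U x :: ereal)} = U" by (auto simp: indicator_def split: if_splits)
    then show ?thesis by simp
  next
    case 3
    then have "{x. t < (indicator U x :: ereal)} = {}"
      using order_trans[OF _ 3, of 0] by (simp add: indicator_def not_less)
    then show ?thesis by simp
  qed
  then show "open {x. t < (indicator U x :: ereal)}" using assms by auto
qed

text \<open>Kindler's construction: the regions between graphs of functions in \<^term>\<open>L\<close> form a semiring on
  which \<open>region f g \<mapsto> \<Lambda> (g - f)\<close> is countably additive, because lengths of fibres are; the measure is
  the trace on the strip of height one of the Caratheodory extension.\<close>
theorem daniell_stone:
  fixes \<Lambda> :: "('a \<Rightarrow> real) \<Rightarrow> real"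
  assumes add: "\<And>f g. f \<in> L \<Longrightarrow> g \<in> L \<Longrightarrow> \<Lambda> (\<lambda>x. f x + g x) = \<Lambda> f + \<Lambda> g"
    and scale: "\<And>f a. f \<in> L \<Longrightarrow> \<Lambda> (\<lambda>x. a * f x) = a * \<Lambda> f"
    and pos: "\<And>f. f \<in> L \<Longrightarrow> (\<And>x. 0 \<le> f x) \<Longrightarrow> 0 \<le> \<Lambda> f"
    and one: "\<Lambda> (\<lambda>x. 1) = 1"
    and continuous: "\<And>fs. (\<And>n. fs n \<in> L) \<Longrightarrow> (\<And>x. decseq (\<lambda>n. fs n x)) \<Longrightarrow>
      (\<And>x. (\<lambda>n. fs n x) \<longlonglongrightarrow> 0) \<Longrightarrow> (\<lambda>n. \<Lambda> (fs n)) \<longlonglongrightarrow> 0"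
  shows "\<exists>Q. prob_space Q \<and> sets Q = sets borel \<and> (\<forall>f\<in>L. integral\<^sup>L Q f = \<Lambda> f)"
proof -
  have zero: "\<Lambda> (\<lambda>x. 0) = 0" using scale[OF L_const, of 0 0] by simp
  have const: "\<Lambda> (\<lambda>x. a) = a" for a using scale[OF L_const, of a 1] one by simp
  have diff: "\<Lambda> (\<lambda>x. f x - g x) = \<Lambda> f - \<Lambda> g" if "f \<in> L" "g \<in> L" for f g
    using add[OF that(1) L_scale[OF that(2)], of "-1"] scale[OF that(2), of "-1"] by simp
  have \<Lambda>_sum: "\<Lambda> (\<lambda>x. \<Sum>k<n. f k x) = (\<Sum>k<n. \<Lambda> (f k))" if "\<And>k. f k \<in> L" for f and n :: nat
    by (induction n) (simp_all add: zero add[OF L_sum that] that)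
  define P where "P = (\<lambda>f g. f \<in> L \<and> g \<in> L \<and> (\<forall>x. f x \<le> g x))"
  define \<mu> where "\<mu> = (\<lambda>f g. ennreal (\<Lambda> (\<lambda>x. g x - f x)))"
  define M where "M = extend_measure UNIV {(f, g). P f g} (\<lambda>(f, g). region f g) (\<lambda>(f, g). \<mu> f g)"
  have fibre: "emeasure lborel {t. (x, t) \<in> region f g} = ennreal (g x - f x)" if "P f g" for f g x
    using that unfolding region_fibre P_def by simp
  have emeasure_M: "emeasure M (region f g) = \<mu> f g" if "P f g" for f g
  proof (rule extend_measure_caratheodory_pair[OF M_def, OF that])
    show "semiring_of_sets UNIV {region f g | f g. P f g}"
      unfolding P_def by (rule semiring_regions)
  next
    fix f g assume "P f g" "region f g = {}"
    then have "f x = g x" for x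
      unfolding P_def region_def by (metis (mono_tags, lifting) antisym_conv2 case_prodI empty_Collect_eq order_refl)
    then show "\<mu> f g = 0" unfolding \<mu>_def by (simp add: zero)
  next
    fix f g f' g' assume "P f g" "P f' g'" and eq: "region f g = region f' g'"
    \<comment> \<open>The same region can come from different pairs of functions; the Lebesgue
      measure of the fibres shows that the assigned value depends on the set alone.\<close>
    then have "ennreal (g x - f x) = ennreal (g' x - f' x)" for x
      using fibre[of f g x] fibre[of f' g' x] by simp
    moreover have "0 \<le> g x - f x" "0 \<le> g' x - f' x" for x
      using \<open>P f g\<close> \<open>P f' g'\<close> unfolding P_def by auto
    ultimately have "g x - f x = g' x - f' x" for x by simp
    then show "\<mu> f g = \<mu> f' g'" unfolding \<mu>_def by simp
  next
    fix A B :: "nat \<Rightarrow> 'a \<Rightarrow> real" and f g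
    assume AB: "\<And>n. P (A n) (B n)" and fg: "P f g"
      and disj: "disjoint_family (\<lambda>n. region (A n) (B n))" and Un: "(\<Union>n. region (A n) (B n)) = region f g"
    define D where "D = (\<lambda>n x. B n x - A n x)"
    have D: "D n \<in> L" "0 \<le> D n x" for n x using AB unfolding D_def P_def by (auto intro: L_diff)
    have d: "(\<lambda>x. g x - f x) \<in> L" "0 \<le> g x - f x" for x using fg unfolding P_def by (auto intro: L_diff)
    \<comment> \<open>Countable additivity is borrowed from Lebesgue measure on each fibre. It gives
      pointwise convergence only; the remainders \<open>r n\<close> then decrease to 0 and the
      continuity of \<open>\<Lambda>\<close> does the rest.\<close>
    have D_sums: "(\<lambda>n. D n x) sums (g x - f x)" for x
    proof -
      have "(\<Sum>n. emeasure lborel {t. (x, t) \<in> region (A n) (B n)}) =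
          emeasure lborel (\<Union>n. {t. (x, t) \<in> region (A n) (B n)})"
      proof (rule suminf_emeasure)
        show "range (\<lambda>n. {t. (x, t) \<in> region (A n) (B n)}) \<subseteq> sets lborel"
          by (auto simp: region_fibre)
        show "disjoint_family (\<lambda>n. {t. (x, t) \<in> region (A n) (B n)})"
          using disj unfolding disjoint_family_on_def by blast
      qed
      also have "(\<Union>n. {t. (x, t) \<in> region (A n) (B n)}) = {t. (x, t) \<in> region f g}"
        unfolding Un[symmetric] by auto
      finally have "(\<Sum>n. ennreal (D n x)) = ennreal (g x - f x)"
        unfolding D_def using fibre[OF AB] fibre[OF fg] by simp
      moreover have "(\<lambda>n. ennreal (D n x)) sums (\<Sum>n. ennreal (D n x))"
        by (intro summable_sums summableI)
      ultimately show ?thesis using d(2)[of x] D(2) by (simp add: sums_ennreal)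
    qed
    define r where "r = (\<lambda>n x. (g x - f x) - (\<Sum>k<n. D k x))"
    have "(\<lambda>n. \<Lambda> (r n)) \<longlonglongrightarrow> 0"
    proof (rule continuous)
      show "r n \<in> L" for n unfolding r_def by (intro L_diff d L_sum D) (use fg in \<open>auto simp: P_def\<close>)
      show "decseq (\<lambda>n. r n x)" for x
        unfolding r_def by (rule decseq_SucI) (simp add: D)
      have "(\<lambda>n. (g x - f x) - (\<Sum>k<n. D k x)) \<longlonglongrightarrow> (g x - f x) - (g x - f x)" for x
        using D_sums[of x] unfolding sums_def by (intro tendsto_diff tendsto_const)
      then show "(\<lambda>n. r n x) \<longlonglongrightarrow> 0" for x unfolding r_def by simp
    qed
    moreover have "\<Lambda> (r n) = \<Lambda> (\<lambda>x. g x - f x) - (\<Sum>k<n. \<Lambda> (D k))" for n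
      unfolding r_def using diff[OF d(1) L_sum, of "{..<n}" D] D(1) \<Lambda>_sum[of D n] by simp
    ultimately have "(\<lambda>n. \<Lambda> (\<lambda>x. g x - f x) - (\<Lambda> (\<lambda>x. g x - f x) - (\<Sum>k<n. \<Lambda> (D k)))) \<longlonglongrightarrow> \<Lambda> (\<lambda>x. g x - f x) - 0"
      by (intro tendsto_diff tendsto_const) simp
    then have "(\<lambda>k. \<Lambda> (D k)) sums \<Lambda> (\<lambda>x. g x - f x)" unfolding sums_def by simp
    then show "(\<Sum>n. \<mu> (A n) (B n)) = \<mu> f g"
      unfolding \<mu>_def using pos[OF D] by (intro suminf_ennreal_eq) (simp_all add: D_def)
  qed simp
  have space_M: "space M = UNIV" unfolding M_def by (simp add: space_extend_measure)
  have sets_M: "region f g \<in> sets M" if "P f g" for f g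
  proof -
    have "sets M = sigma_sets UNIV ((\<lambda>(f, g). region f g) ` {(f, g). P f g})"
      unfolding M_def by (rule sets_extend_measure) simp
    then show ?thesis using that by auto
  qed
  have open_sets: "U \<times> {0..<1} \<in> sets M" if U: "open U" for U :: "'a set"
  proof -
    have "0 \<le> (indicator U x :: ereal)" for x by (simp add: indicator_def)
    then obtain \<phi> :: "nat \<Rightarrow> 'a \<Rightarrow> real" where \<phi>: "\<And>n. \<phi> n \<in> L" "\<And>n x. 0 \<le> \<phi> n x"
        "\<And>x. (SUP n. ereal (\<phi> n x)) = indicator U x"
      using lsc_approximation[OF lsc_indicator[OF U]] by metis
    \<comment> \<open>The approximants of the indicator never exceed 1, and a height
      \<open>t < 1\<close> over a point of \<open>U\<close> is passed by one of them; the strict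
      upper bound of regions is essential here.\<close>
    have "U \<times> {0..<1} = (\<Union>n. region (\<lambda>x. 0) (\<phi> n))"
    proof safe
      fix x and t :: real assume "x \<in> U" "t \<in> {0..<1}"
      then have "ereal t < (SUP n. ereal (\<phi> n x))" using \<phi>(3)[of x] by simp
      then show "(x, t) \<in> (\<Union>n. region (\<lambda>x. 0) (\<phi> n))"
        using \<open>t \<in> {0..<1}\<close> unfolding less_SUP_iff region_def by auto
    next
      fix n x and t :: real assume *: "(x, t) \<in> region (\<lambda>x. 0) (\<phi> n)"
      have "ereal (\<phi> n x) \<le> indicator U x" unfolding \<phi>(3)[symmetric] by (rule SUP_upper) simp
      then have "\<phi> n x \<le> indicator U x" by (cases "x \<in> U") simp_all
      then show "x \<in> U" "t \<in> {0..<1}"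
        using * unfolding region_def by (cases "x \<in> U"; simp)+
    qed
    moreover have "region (\<lambda>x. 0) (\<phi> n) \<in> sets M" for n
      using \<phi> L_const by (intro sets_M) (auto simp: P_def)
    ultimately show ?thesis by auto
  qed
  define N where "N = restrict_space M (UNIV \<times> {0..<1})"
  have strip: "UNIV \<times> {0..<1} \<inter> space M \<in> sets M" using open_sets[OF open_UNIV] by (simp add: space_M)
  have space_N: "space N = UNIV \<times> {0..<1}" unfolding N_def space_restrict_space space_M by simp
  have fst_N: "fst \<in> borel_measurable N"
  proof (rule borel_measurableI)
    fix U :: "'a set" assume "open U"
    then have "U \<times> {0..<1} \<in> sets N"
      unfolding N_def using strip by (auto simp: sets_restrict_space_iff open_sets)
    moreover have "fst -` U \<inter> space N = U \<times> {0..<1}" unfolding space_N by auto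
    ultimately show "fst -` U \<inter> space N \<in> sets N" by simp
  qed
  define Q where "Q = distr N borel fst"
  have sets_Q: "sets Q = sets borel" unfolding Q_def by simp
  have emeasure_Q: "emeasure Q U = emeasure M (U \<times> {0..<1})" if "U \<in> sets borel" for U
  proof -
    have "fst -` U \<inter> space N = U \<times> {0..<1}" unfolding space_N by auto
    then have "emeasure Q U = emeasure N (U \<times> {0..<1})"
      unfolding Q_def using that fst_N by (simp add: emeasure_distr)
    also have "\<dots> = emeasure M (U \<times> {0..<1})"
      unfolding N_def using strip by (intro emeasure_restrict_space) auto
    finally show ?thesis .
  qed
  have "UNIV \<times> {0..<1} = region (\<lambda>x::'a. 0) (\<lambda>x. 1)" unfolding region_def by auto
  then have "emeasure Q UNIV = 1"
    using emeasure_Q[of UNIV] emeasure_M[of "\<lambda>x. 0" "\<lambda>x. 1"] by (simp add: P_def L_const \<mu>_def one)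
  then have Q: "prob_space Q" by (intro prob_spaceI) (simp add: Q_def)
  interpret prob_space Q by fact
  have integrable: "integrable Q f" if f: "f \<in> L" for f
  proof -
    obtain B where "\<And>x. norm (f x) \<le> B" using L_bounded[OF f] unfolding bounded_iff by auto
    moreover have "f \<in> borel_measurable Q"
      using borel_measurable_continuous_onI[OF L_continuous[OF f]] by (simp add: measurable_cong_sets[OF sets_Q refl])
    ultimately show ?thesis by (intro integrable_const_bound) auto
  qed
  \<comment> \<open>The link between the functional and the measure: the region under
    \<open>\<phi>\<close> lies in the cylinder of height one over the set where
    \<open>\<phi>\<close> is positive.\<close>
  have support: "\<Lambda> \<phi> \<le> prob {x. 0 < \<phi> x}" if \<phi>: "\<phi> \<in> L" "\<And>x. 0 \<le> \<phi> x" "\<And>x. \<phi> x \<le> 1" for \<phi>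
  proof -
    have op: "open {x. 0 < \<phi> x}" using \<phi>(1) by (rule L_open_greater)
    have "ennreal (\<Lambda> \<phi>) = emeasure M (region (\<lambda>x. 0) \<phi>)"
      using emeasure_M[of "\<lambda>x. 0" \<phi>] \<phi> by (simp add: P_def L_const \<mu>_def)
    also have "\<dots> \<le> emeasure M ({x. 0 < \<phi> x} \<times> {0..<1})"
      using \<phi>(3) by (intro emeasure_mono open_sets op) (force simp: region_def intro: less_le_trans)
    also have "\<dots> = ennreal (prob {x. 0 < \<phi> x})"
      using emeasure_Q[of "{x. 0 < \<phi> x}"] op by (simp add: emeasure_eq_measure)
    finally show ?thesis by simp
  qed
  have below: "\<Lambda> f \<le> integral\<^sup>L Q f" if f: "f \<in> L" "\<And>x. 0 \<le> f x" "\<And>x. f x \<le> 1" for f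
  proof (rule field_le_epsilon)
    fix e :: real assume "0 < e"
    then obtain n where n: "1 / real (Suc n) < e" using nat_approx_posE by blast
    define m where "m = real (Suc n)"
    have m: "m > 0" unfolding m_def by simp
    \<comment> \<open>The layer of \<open>m * f\<close> between the heights \<open>k\<close> and
      \<open>k + 1\<close>; as \<open>f \<le> 1\<close>, the first \<open>m\<close> layers add up to
      \<open>m * f\<close>.\<close>
    define \<phi> where "\<phi> = (\<lambda>k x. min (max (m * f x + - real k) 0) 1)"
    have \<phi>: "\<phi> k \<in> L" "0 \<le> \<phi> k x" "\<phi> k x \<le> 1" for k x
      unfolding \<phi>_def by (intro L_min L_max L_add L_scale L_const f) auto
    have "(\<Sum>k<j. min (max (y + - real k) 0) 1) = min y (real j)" if "0 \<le> y" for j y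
      using that by (induction j) (auto simp: min_def max_def)
    then have "(\<Sum>k<j. \<phi> k x) = min (m * f x) (real j)" for j x
      unfolding \<phi>_def using f(2)[of x] m by simp
    moreover have "m * f x \<le> m" for x using f(3)[of x] m by simp
    ultimately have \<phi>_sum: "(\<Sum>k<Suc n. \<phi> k x) = m * f x" for x
      by (metis m_def min.absorb1)
    have level: "{x. 0 < \<phi> k x} = {x. real k / m < f x}" for k
      using m unfolding \<phi>_def by (auto simp: field_simps min_def max_def)
    define U where "U = (\<lambda>k. {x. real k / m < f x})"
    have U: "U k \<in> sets Q" for k
      unfolding U_def sets_Q using L_open_greater[OF f(1)] by simp
    have "m * \<Lambda> f = (\<Sum>k<Suc n. \<Lambda> (\<phi> k))"
      using \<Lambda>_sum[of \<phi> "Suc n"] \<phi>(1) \<phi>_sum scale[OF f(1)] by simp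
    also have "\<dots> \<le> (\<Sum>k<Suc n. prob (U k))"
      unfolding U_def level[symmetric] by (intro sum_mono support \<phi>)
    also have "\<dots> = (\<integral>x. (\<Sum>k<Suc n. indicator (U k) x) \<partial>Q)"
      using U by (subst Bochner_Integration.integral_sum) (auto simp: less_top[symmetric])
    also have "\<dots> \<le> (\<integral>x. m * f x + 1 \<partial>Q)"
    proof (rule integral_mono)
      show "integrable Q (\<lambda>x. \<Sum>k<Suc n. indicator (U k) x :: real)"
        using U by (intro Bochner_Integration.integrable_sum) (auto simp: less_top[symmetric])
      show "integrable Q (\<lambda>x. m * f x + 1)" using integrable[OF f(1)] by simp
      fix x
      \<comment> \<open>The sum counts the \<open>k < j\<close> with \<open>k < m * f x\<close>. The
        bound by \<open>j\<close> is carried along because the induction step for the second bound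
        needs it. The loss of 1 becomes \<open>1 / m\<close> after division.\<close>
      have "(\<Sum>k<j. indicator (U k) x) \<le> real j \<and> (\<Sum>k<j. indicator (U k) x) \<le> m * f x + 1" for j
        using f(2)[of x] m by (induction j) (auto simp: U_def indicator_def field_simps)
      then show "(\<Sum>k<Suc n. indicator (U k) x) \<le> m * f x + 1" by blast
    qed
    also have "\<dots> = m * integral\<^sup>L Q f + 1" using integrable[OF f(1)] prob_space by simp
    finally have "\<Lambda> f \<le> integral\<^sup>L Q f + 1 / m" using m by (simp add: field_simps)
    then show "\<Lambda> f \<le> integral\<^sup>L Q f + e" using n unfolding m_def by simp
  qed
  have "integral\<^sup>L Q f = \<Lambda> f" if f: "f \<in> L" for f
  proof -
    obtain B where B: "B > 0" "\<And>x. \<bar>f x\<bar> \<le> B"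
      using L_bounded[OF f] unfolding bounded_pos by auto
    \<comment> \<open>Normalized to values in the unit interval, so that \<open>below\<close>
      applies both to \<open>g\<close> and to \<open>1 - g\<close>; as both functionals map 1 to 1,
      the two inequalities give equality.\<close>
    define g where "g = (\<lambda>x. 1 / (2 * B) * (f x + B))"
    have g: "g \<in> L" unfolding g_def by (intro L_scale L_add L_const f)
    have g01: "0 \<le> g x" "g x \<le> 1" for x
      using B(1) B(2)[of x] unfolding g_def by (auto simp: field_simps abs_le_iff)
    have "\<Lambda> g \<le> integral\<^sup>L Q g" using below[OF g g01] .
    moreover have "\<Lambda> (\<lambda>x. 1 - g x) \<le> (\<integral>x. 1 - g x \<partial>Q)"
      using g g01 by (intro below L_diff L_const) auto
    then have "integral\<^sup>L Q g \<le> \<Lambda> g" using integrable[OF g] diff[OF L_const g] const prob_space by simp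
    ultimately have eq: "integral\<^sup>L Q g = \<Lambda> g" by simp
    have "\<Lambda> g = 1 / (2 * B) * (\<Lambda> f + B)"
      unfolding g_def scale[OF L_add[OF f L_const]] add[OF f L_const] const ..
    moreover have "integral\<^sup>L Q g = 1 / (2 * B) * (integral\<^sup>L Q f + B)"
      unfolding g_def using integrable[OF f] prob_space by simp
    ultimately show ?thesis using eq B(1) by simp
  qed
  then show ?thesis using Q sets_Q by blast
qed

end

section \<open>Convex risk measures\<close>

context lattice_capacity
begin

lemma function_subspace_L1: "function_subspace (L1 L c)"
  unfolding function_subspace_def using L1_add L1_scale L1_L[OF L_const] by blast

text \<open>Monotonicity of \<open>c\<close> upgrades the infimum in the capacity axiom to a limit,
  the form required by \<open>daniell_stone\<close>.\<close>

lemma c_tendsto_zero: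
  assumes "\<And>n. fs n \<in> L" "\<And>x. decseq (\<lambda>n. fs n x)" "\<And>x. (\<lambda>n. fs n x) \<longlonglongrightarrow> 0"
  shows "(\<lambda>n. c (fs n)) \<longlonglongrightarrow> 0"
proof (rule LIMSEQ_I)
  fix e :: real assume "0 < e"
  then obtain N where N: "c (fs N) < e" using c_downward[of fs] assms by blast
  have "norm (c (fs n) - 0) < e" if "n \<ge> N" for n
  proof -
    have "\<bar>fs n x\<bar> \<le> \<bar>fs N x\<bar>" for x
      using decseqD[OF assms(2)[of x] that] decseq_ge[OF assms(2)[of x] assms(3)[of x], of n] by simp
    then have "c (fs n) \<le> c (fs N)" using assms(1) by (intro c_mono)
    then show ?thesis using N c_nonneg[OF assms(1)] by simp
  qed
  then show "\<exists>N. \<forall>n\<ge>N. norm (c (fs n) - 0) < e" by blast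
qed

end

locale convex_risk = lattice_capacity L c
  for L :: "('a::topological_space \<Rightarrow> real) set" and c +
  fixes \<rho> :: "('a \<Rightarrow> real) \<Rightarrow> real"
  assumes risk: "convex_risk_measure L c \<rho>"
begin

section \<open>Local boundedness and continuity of the risk measure\<close>

lemma risk_antimono: "g \<in> L1 L c \<Longrightarrow> h \<in> L1 L c \<Longrightarrow> L1_nonneg L c (\<lambda>x. h x - g x) \<Longrightarrow> \<rho> h \<le> \<rho> g"
  and risk_convex: "g \<in> L1 L c \<Longrightarrow> h \<in> L1 L c \<Longrightarrow> 0 \<le> t \<Longrightarrow> t \<le> 1 \<Longrightarrow>
    \<rho> (\<lambda>x. t * g x + (1 - t) * h x) \<le> t * \<rho> g + (1 - t) * \<rho> h"
  and risk_translate: "g \<in> L1 L c \<Longrightarrow> \<rho> (\<lambda>x. g x + a) = \<rho> g - a"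
  using risk unfolding convex_risk_measure_def L1_le_def by blast+

text \<open>Otherwise the sum of a sequence of counterexamples with summable capacities would dominate
  all of them, although their risks are unbounded.\<close>
lemma risk_locally_bounded:
  assumes g: "g \<in> L1 L c"
  shows "\<exists>\<delta>>0. \<exists>M>0. \<forall>h\<in>L1 L c. cap L c h < ereal \<delta> \<longrightarrow> \<rho> (\<lambda>x. g x + h x) - \<rho> g \<le> M"
proof -
  have "\<exists>n::nat. \<forall>h\<in>L1 L c. cap L c h \<le> ereal ((1/2) ^ n) \<longrightarrow> \<rho> (\<lambda>x. g x + h x) \<le> real n"
  proof (rule ccontr)
    assume "\<not> ?thesis"
    then have "\<forall>n::nat. \<exists>h\<in>L1 L c. cap L c h \<le> ereal ((1/2) ^ n) \<and> real n < \<rho> (\<lambda>x. g x + h x)"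
      by (simp add: not_le)
    then obtain h where h: "\<And>n. h n \<in> L1 L c" "\<And>n. cap L c (h n) \<le> ereal ((1/2) ^ n)"
        "\<And>n. real n < \<rho> (\<lambda>x. g x + h n x)"
      by metis
    obtain k where k: "k \<in> L1 L c" "\<And>n. L1_nonneg L c (\<lambda>x. h n x + k x)"
      using L1_dominating[OF h(1,2)] by blast
    have "real n < \<rho> (\<lambda>x. g x - k x)" for n
    proof -
      \<comment> \<open>The position \<open>g - k\<close> lies below every \<open>g + h n\<close>,
        so its risk would have to exceed every integer.\<close>
      have "\<rho> (\<lambda>x. g x + h n x) \<le> \<rho> (\<lambda>x. g x - k x)"
        using k(2)[of n] by (intro risk_antimono L1_diff L1_add g h k) (simp add: algebra_simps)
      then show ?thesis using h(3)[of n] by simp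
    qed
    then show False using reals_Archimedean2[of "\<rho> (\<lambda>x. g x - k x)"] less_asym by blast
  qed
  then obtain n :: nat where n: "\<And>h. h \<in> L1 L c \<Longrightarrow> cap L c h \<le> ereal ((1/2) ^ n) \<Longrightarrow>
      \<rho> (\<lambda>x. g x + h x) \<le> real n" by blast
  show ?thesis
  proof (intro exI conjI ballI impI)
    show "(0::real) < (1/2) ^ n" "0 < \<bar>real n - \<rho> g\<bar> + 1" by auto
    fix h assume "h \<in> L1 L c" "cap L c h < ereal ((1/2) ^ n)"
    then have "\<rho> (\<lambda>x. g x + h x) \<le> real n" using n by (simp add: less_imp_le)
    then show "\<rho> (\<lambda>x. g x + h x) - \<rho> g \<le> \<bar>real n - \<rho> g\<bar> + 1" by simp
  qed
qed

text \<open>Contracting towards \<open>g\<close> by a factor \<open>t\<close> shrinks the local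
  upper bound by \<open>t\<close>; reflecting at \<open>g\<close> turns the upper bound into a lower
  one.\<close>

lemma risk_continuous: "L1_continuous L c \<rho>"
  unfolding L1_continuous_def
proof (intro ballI allI impI)
  fix g and e :: real assume g: "g \<in> L1 L c" and e: "0 < e"
  obtain \<delta> M where \<delta>: "\<delta> > 0" "M > 0"
    and M: "\<And>h. h \<in> L1 L c \<Longrightarrow> cap L c h < ereal \<delta> \<Longrightarrow> \<rho> (\<lambda>x. g x + h x) - \<rho> g \<le> M"
    using risk_locally_bounded[OF g] by blast
  define t where "t = min 1 (e / (2 * M))"
  have t: "0 < t" "t \<le> 1" "t * M < e"
  proof -
    show "0 < t" "t \<le> 1" unfolding t_def using e \<delta> by auto
    have "t * M \<le> e / (2 * M) * M" unfolding t_def using \<delta> by (intro mult_right_mono) auto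
    also have "\<dots> < e" using \<delta> e by simp
    finally show "t * M < e" .
  qed
  have upper: "\<rho> (\<lambda>x. g x + h x) - \<rho> g \<le> t * M" if h: "h \<in> L1 L c" "cap L c h < ereal (\<delta> * t)" for h
  proof -
    \<comment> \<open>The enlarged increment \<open>h / t\<close> still lies in the ball where the
      bound holds, and \<open>g + h\<close> is the point dividing the segment from \<open>g\<close>
      to \<open>g + h / t\<close>.\<close>
    have "cap L c (\<lambda>x. (1 / t) * h x) < ereal (\<bar>1 / t\<bar> * (\<delta> * t))"
      using t h(2) by (intro cap_scale_less) auto
    also have "\<bar>1 / t\<bar> * (\<delta> * t) = \<delta>" using t by simp
    finally have "\<rho> (\<lambda>x. g x + (1 / t) * h x) - \<rho> g \<le> M"
      using L1_scale[OF h(1)] by (intro M)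
    then have "t * \<rho> (\<lambda>x. g x + (1 / t) * h x) + (1 - t) * \<rho> g \<le> \<rho> g + t * M"
      using mult_left_mono[of "\<rho> (\<lambda>x. g x + (1 / t) * h x) - \<rho> g" M t] t by (simp add: algebra_simps)
    moreover have "\<rho> (\<lambda>x. t * (g x + (1 / t) * h x) + (1 - t) * g x) \<le>
        t * \<rho> (\<lambda>x. g x + (1 / t) * h x) + (1 - t) * \<rho> g"
      using t by (intro risk_convex L1_add L1_scale g h) auto
    moreover have "(\<lambda>x. t * (g x + (1 / t) * h x) + (1 - t) * g x) = (\<lambda>x. g x + h x)"
      using t by (simp add: algebra_simps)
    ultimately show ?thesis by simp
  qed
  show "\<exists>\<delta>>0. \<forall>h\<in>L1 L c. cap L c (\<lambda>x. h x - g x) < ereal \<delta> \<longrightarrow> \<bar>\<rho> h - \<rho> g\<bar> < e"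
  proof (intro exI[of _ "\<delta> * t"] conjI ballI impI)
    show "0 < \<delta> * t" using \<delta> t by simp
    fix h assume h: "h \<in> L1 L c" "cap L c (\<lambda>x. h x - g x) < ereal (\<delta> * t)"
    have "\<rho> (\<lambda>x. g x + (h x - g x)) - \<rho> g \<le> t * M"
      using h g by (intro upper L1_diff)
    moreover have "\<rho> (\<lambda>x. g x + (g x - h x)) - \<rho> g \<le> t * M"
      using h g by (intro upper L1_diff) (simp_all add: cap_commute[of g h])
    \<comment> \<open>\<open>g\<close> is the midpoint of \<open>h\<close> and its reflection
      \<open>2 * g - h\<close>, whose risk is already bounded above.\<close>
    moreover have "\<rho> (\<lambda>x. 1/2 * h x + (1 - 1/2) * (g x + (g x - h x))) \<le>
        1/2 * \<rho> h + (1 - 1/2) * \<rho> (\<lambda>x. g x + (g x - h x))"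
      using h g by (intro risk_convex L1_add L1_diff) auto
    moreover have "(\<lambda>x. 1/2 * h x + (1 - 1/2) * (g x + (g x - h x))) = g"
      by (simp add: algebra_simps)
    ultimately show "\<bar>\<rho> h - \<rho> g\<bar> < e" using t(3) by simp
  qed
qed

text \<open>The increment of the risk at \<open>g\<close> is convex and vanishes at 0, so it
  dominates a linear form. Its local upper bound, applied to both signs and rescaled, makes this
  form bounded with respect to \<open>cap\<close>.\<close>

lemma subgradient:
  assumes g: "g \<in> L1 L c"
  shows "\<exists>l K. linear_form_on (L1 L c) l \<and> (\<forall>h\<in>L1 L c. l h \<le> \<rho> (\<lambda>x. g x + h x) - \<rho> g) \<and>
    (\<forall>h\<in>L1 L c. \<forall>r. cap L c h < ereal r \<longrightarrow> \<bar>l h\<bar> \<le> K * r)"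
proof -
  define \<phi> where "\<phi> = (\<lambda>h. \<rho> (\<lambda>x. g x + h x) - \<rho> g)"
  have "\<exists>l. linear_form_on (L1 L c) l \<and> (\<forall>h\<in>L1 L c. l h \<le> \<phi> h)"
  proof (rule convex_dominates_linear_form[OF function_subspace_L1])
    fix f h and t :: real assume "f \<in> L1 L c" "h \<in> L1 L c" "0 \<le> t" "t \<le> 1"
    then have "\<rho> (\<lambda>x. t * (g x + f x) + (1 - t) * (g x + h x)) \<le>
        t * \<rho> (\<lambda>x. g x + f x) + (1 - t) * \<rho> (\<lambda>x. g x + h x)"
      using g by (intro risk_convex L1_add)
    moreover have "(\<lambda>x. t * (g x + f x) + (1 - t) * (g x + h x)) = (\<lambda>x. g x + (t * f x + (1 - t) * h x))"
      by (simp add: algebra_simps)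
    ultimately show "\<phi> (\<lambda>x. t * f x + (1 - t) * h x) \<le> t * \<phi> f + (1 - t) * \<phi> h"
      unfolding \<phi>_def by (simp add: algebra_simps)
  qed (simp add: \<phi>_def)
  then obtain l where l: "linear_form_on (L1 L c) l" and le: "\<And>h. h \<in> L1 L c \<Longrightarrow> l h \<le> \<phi> h"
    by blast
  obtain \<delta> M where \<delta>: "\<delta> > 0"
    and M: "\<And>h. h \<in> L1 L c \<Longrightarrow> cap L c h < ereal \<delta> \<Longrightarrow> \<phi> h \<le> M"
    using risk_locally_bounded[OF g] unfolding \<phi>_def by blast
  have scale: "l (\<lambda>x. a * h x) = a * l h" if "h \<in> L1 L c" for a h
    using l that unfolding linear_form_on_def by blast
  have "\<bar>l h\<bar> \<le> M / \<delta> * r" if h: "h \<in> L1 L c" and less: "cap L c h < ereal r" for h r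
  proof -
    have "0 < ereal r" using cap_nonneg less by (rule le_less_trans)
    then have r: "r > 0" by simp
    have *: "a * l h \<le> M" if "\<bar>a\<bar> = \<delta> / r" for a
    proof -
      have "cap L c (\<lambda>x. a * h x) < ereal (\<bar>a\<bar> * r)"
        using less that \<delta> r by (intro cap_scale_less) auto
      then have "cap L c (\<lambda>x. a * h x) < ereal \<delta>" using that r by simp
      then have "\<phi> (\<lambda>x. a * h x) \<le> M" using h by (intro M L1_scale)
      then show ?thesis using le[OF L1_scale[OF h], of a] scale[OF h] by simp
    qed
    have "\<delta> / r * l h \<le> M" "- (\<delta> / r) * l h \<le> M" using \<delta> r by (intro *; simp)+
    then have "\<delta> / r * \<bar>l h\<bar> \<le> M" by (cases "l h \<ge> 0") simp_all
    then show ?thesis using \<delta> r by (simp add: field_simps)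
  qed
  then show ?thesis using l le unfolding \<phi>_def by blast
qed

text \<open>Resolves the definite description in \<open>EQ\<close>: the bounded form
  \<open>\<Lambda>\<close> agrees with the integral on \<open>L\<close>, so it gives the limit along
  every approximating sequence, and uniqueness holds because such a sequence exists.\<close>

lemma EQ_eqI:
  assumes Q: "\<And>f. f \<in> L \<Longrightarrow> integral\<^sup>L Q f = \<Lambda> f"
    and diff: "\<And>f g. f \<in> L1 L c \<Longrightarrow> g \<in> L1 L c \<Longrightarrow> \<Lambda> (\<lambda>x. f x - g x) = \<Lambda> f - \<Lambda> g"
    and bound: "\<And>h r. h \<in> L1 L c \<Longrightarrow> cap L c h < ereal r \<Longrightarrow> \<bar>\<Lambda> h\<bar> \<le> K * r"
    and h: "h \<in> L1 L c"
  shows "EQ L c Q h = \<Lambda> h"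
proof -
  have lim: "(\<lambda>n. integral\<^sup>L Q (fs n)) \<longlonglongrightarrow> \<Lambda> h"
    if fs: "\<And>n. fs n \<in> L" and cap: "(\<lambda>n. cap L c (\<lambda>x. h x - fs n x)) \<longlonglongrightarrow> 0" for fs :: "nat \<Rightarrow> 'a \<Rightarrow> real"
  proof (rule LIMSEQ_I)
    fix e :: real assume e: "0 < e"
    \<comment> \<open>The denominator is positive for every real \<open>K\<close>, and
      \<open>K * r\<close> stays strictly below \<open>e\<close>.\<close>
    define r where "r = e / (\<bar>K\<bar> + 1)"
    have r: "r > 0" unfolding r_def using e by simp
    have "K * r \<le> \<bar>K\<bar> * r" using r by (intro mult_right_mono) auto
    also have "\<dots> < (\<bar>K\<bar> + 1) * r" using r by simp
    also have "\<dots> = e" unfolding r_def by simp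
    finally have Kr: "K * r < e" .
    have "\<forall>\<^sub>F n in sequentially. cap L c (\<lambda>x. h x - fs n x) < ereal r"
      using cap r by (intro order_tendstoD(2)) auto
    then obtain N where N: "\<And>n. n \<ge> N \<Longrightarrow> cap L c (\<lambda>x. h x - fs n x) < ereal r"
      unfolding eventually_sequentially by blast
    have "norm (integral\<^sup>L Q (fs n) - \<Lambda> h) < e" if "n \<ge> N" for n
      using bound[OF L1_diff[OF h L1_L[OF fs]] N[OF that]] diff[OF h L1_L[OF fs], of n] Q[OF fs, of n] Kr
      by simp
    then show "\<exists>N. \<forall>n\<ge>N. norm (integral\<^sup>L Q (fs n) - \<Lambda> h) < e" by blast
  qed
  show ?thesis
    unfolding EQ_def
  proof (rule the_equality)
    show "\<forall>fs. (\<forall>n. fs n \<in> L) \<and> (\<lambda>n. cap L c (\<lambda>x. h x - fs n x)) \<longlonglongrightarrow> 0 \<longrightarrow>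
        (\<lambda>n. integral\<^sup>L Q (fs n)) \<longlonglongrightarrow> \<Lambda> h"
      using lim by blast
    fix y assume y: "\<forall>fs. (\<forall>n. fs n \<in> L) \<and> (\<lambda>n. cap L c (\<lambda>x. h x - fs n x)) \<longlonglongrightarrow> 0 \<longrightarrow>
        (\<lambda>n. integral\<^sup>L Q (fs n)) \<longlonglongrightarrow> y"
    obtain fs where fs: "\<And>n. fs n \<in> L" "(\<lambda>n. cap L c (\<lambda>x. h x - fs n x)) \<longlonglongrightarrow> 0"
      using h unfolding L1_def by auto
    show "y = \<Lambda> h" using LIMSEQ_unique[OF _ lim[OF fs]] y fs by blast
  qed
qed

text \<open>Equality in the Fenchel inequality at a subgradient \<open>l\<close>: the function
  \<open>l h - \<rho> h\<close> is maximal at \<open>h = g\<close>, so the penalty of the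
  representing measure is at most \<open>l g - \<rho> g\<close>.\<close>

lemma risk_attained:
  assumes g: "g \<in> L1 L c"
  shows "\<exists>Q\<in>Pdual L c. ereal (\<rho> g) \<le> ereal (EQ L c Q (\<lambda>x. - g x)) - penalty L c \<rho> Q"
proof -
  obtain l K where l: "linear_form_on (L1 L c) l"
    and le: "\<And>h. h \<in> L1 L c \<Longrightarrow> l h \<le> \<rho> (\<lambda>x. g x + h x) - \<rho> g"
    and bound: "\<And>h r. h \<in> L1 L c \<Longrightarrow> cap L c h < ereal r \<Longrightarrow> \<bar>l h\<bar> \<le> K * r"
    using subgradient[OF g] by blast
  have l_add: "l (\<lambda>x. f x + h x) = l f + l h" if "f \<in> L1 L c" "h \<in> L1 L c" for f h
    using l that unfolding linear_form_on_def by blast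
  have l_scale: "l (\<lambda>x. a * f x) = a * l f" if "f \<in> L1 L c" for f a
    using l that unfolding linear_form_on_def by blast
  have l_minus: "l (\<lambda>x. - f x) = - l f" if "f \<in> L1 L c" for f
    using l_scale[OF that, of "-1"] by simp
  have l_diff: "l (\<lambda>x. f x - h x) = l f - l h" if "f \<in> L1 L c" "h \<in> L1 L c" for f h
    using l_add[OF that(1) L1_minus[OF that(2)]] l_minus[OF that(2)] by simp
  \<comment> \<open>The risk decreases as the position increases, so it is the opposite of the
    subgradient that is positive.\<close>
  define \<Lambda> where "\<Lambda> = (\<lambda>f. - l f)"
  have \<Lambda>_bound: "\<bar>\<Lambda> f\<bar> \<le> \<bar>K\<bar> * c f" if f: "f \<in> L" for f
  proof (rule field_le_epsilon)
    fix e :: real assume e: "0 < e"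
    define r where "r = c f + e / (\<bar>K\<bar> + 1)"
    have "cap L c f < ereal r" using e cap_L[OF f] unfolding r_def by simp
    then have "\<bar>\<Lambda> f\<bar> \<le> K * r" using bound[OF L1_L[OF f]] unfolding \<Lambda>_def by simp
    also have "K * r \<le> \<bar>K\<bar> * r" using e c_nonneg[OF f] unfolding r_def by (intro mult_right_mono) auto
    also have "\<dots> = \<bar>K\<bar> * c f + e * (\<bar>K\<bar> / (\<bar>K\<bar> + 1))" unfolding r_def by (simp add: distrib_left)
    also have "e * (\<bar>K\<bar> / (\<bar>K\<bar> + 1)) \<le> e" using e by (intro mult_left_le) auto
    finally show "\<bar>\<Lambda> f\<bar> \<le> \<bar>K\<bar> * c f + e" by simp
  qed
  \<comment> \<open>Translation invariance makes the increment along constants exactly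
    \<open>- a\<close>; using \<open>a = 1\<close> and \<open>a = -1\<close> pins down the value of
    \<open>l\<close> at 1.\<close>
  have const: "l (\<lambda>x. a) \<le> - a" for a
    using le[OF L1_L[OF L_const], of a] risk_translate[OF g] by simp
  have "\<exists>Q. prob_space Q \<and> sets Q = sets borel \<and> (\<forall>f\<in>L. integral\<^sup>L Q f = \<Lambda> f)"
  proof (rule daniell_stone)
    show "\<Lambda> (\<lambda>x. f x + h x) = \<Lambda> f + \<Lambda> h" if "f \<in> L" "h \<in> L" for f h
      unfolding \<Lambda>_def using l_add[OF that[THEN L1_L]] by simp
    show "\<Lambda> (\<lambda>x. a * f x) = a * \<Lambda> f" if "f \<in> L" for f a
      unfolding \<Lambda>_def using l_scale[OF L1_L[OF that]] by simp
    show "0 \<le> \<Lambda> f" if f: "f \<in> L" "\<And>x. 0 \<le> f x" for f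
    proof -
      have "\<rho> (\<lambda>x. g x + f x) \<le> \<rho> g"
        using L1_nonneg_pointwise[OF L1_L[OF f(1)] f(2)]
        by (intro risk_antimono L1_add L1_L f g) simp
      then show ?thesis unfolding \<Lambda>_def using le[OF L1_L[OF f(1)]] by simp
    qed
    show "\<Lambda> (\<lambda>x. 1) = 1"
      unfolding \<Lambda>_def using const[of 1] const[of "-1"] l_minus[OF L1_L[OF L_const], of 1] by simp
    fix fs :: "nat \<Rightarrow> 'a \<Rightarrow> real"
    assume fs: "\<And>n. fs n \<in> L" "\<And>x. decseq (\<lambda>n. fs n x)" "\<And>x. (\<lambda>n. fs n x) \<longlonglongrightarrow> 0"
    have "(\<lambda>n. \<bar>K\<bar> * c (fs n)) \<longlonglongrightarrow> \<bar>K\<bar> * 0"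
      by (rule tendsto_mult[OF tendsto_const c_tendsto_zero[OF fs]])
    then have "(\<lambda>n. \<bar>K\<bar> * c (fs n)) \<longlonglongrightarrow> 0" by simp
    moreover have "\<forall>\<^sub>F n in sequentially. norm (\<Lambda> (fs n)) \<le> \<bar>K\<bar> * c (fs n)"
      using \<Lambda>_bound[OF fs(1)] by simp
    ultimately show "(\<lambda>n. \<Lambda> (fs n)) \<longlonglongrightarrow> 0" by (rule Lim_null_comparison[rotated])
  qed
  then obtain Q where Q: "prob_space Q" "sets Q = sets borel" "\<And>f. f \<in> L \<Longrightarrow> integral\<^sup>L Q f = \<Lambda> f"
    by blast
  have "in_L1_dual L c Q"
    unfolding in_L1_dual_def using \<Lambda>_bound Q(3) by (intro exI[of _ "\<bar>K\<bar>"]) simp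
  then have "Q \<in> Pdual L c" using Q unfolding Pdual_def by simp
  moreover have EQ: "EQ L c Q (\<lambda>x. - h x) = l h" if h: "h \<in> L1 L c" for h
  proof -
    have "EQ L c Q (\<lambda>x. - h x) = \<Lambda> (\<lambda>x. - h x)"
      using Q(3) bound l_diff by (intro EQ_eqI[of _ _ K] L1_minus h) (auto simp: \<Lambda>_def)
    then show ?thesis unfolding \<Lambda>_def using l_minus[OF h] by simp
  qed
  moreover have "penalty L c \<rho> Q \<le> ereal (l g - \<rho> g)"
    unfolding penalty_def
  proof (rule SUP_least)
    fix h assume h: "h \<in> L1 L c"
    have "l h - l g \<le> \<rho> h - \<rho> g" using le[OF L1_diff[OF h g]] l_diff[OF h g] by simp
    then show "ereal (EQ L c Q (\<lambda>x. - h x) - \<rho> h) \<le> ereal (l g - \<rho> g)" using EQ[OF h] by simp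
  qed
  then have "ereal (l g) - ereal (l g - \<rho> g) \<le> ereal (l g) - penalty L c \<rho> Q"
    by (intro ereal_minus_mono order_refl)
  ultimately show ?thesis using EQ[OF g] by (intro bexI[of _ Q]) simp_all
qed

text \<open>Here \<open>g\<close> itself competes in the supremum defining the penalty. The penalty
  is therefore never minus infinity, and where it is infinite the left-hand side is minus
  infinity.\<close>

lemma risk_ge:
  assumes "g \<in> L1 L c"
  shows "ereal (EQ L c Q (\<lambda>x. - g x)) - penalty L c \<rho> Q \<le> ereal (\<rho> g)"
proof -
  have "ereal (EQ L c Q (\<lambda>x. - g x) - \<rho> g) \<le> penalty L c \<rho> Q"
    unfolding penalty_def using assms by (rule SUP_upper)
  then show ?thesis by (cases "penalty L c \<rho> Q") auto
qed

end

theorem theorem3p2: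
  fixes L :: "('a::topological_space \<Rightarrow> real) set"
    and c :: "('a \<Rightarrow> real) \<Rightarrow> real"
    and \<rho> :: "('a \<Rightarrow> real) \<Rightarrow> real"
  assumes "metrizable_space (euclidean :: 'a topology)"
    and "separable_space (euclidean :: 'a topology)"
    and "admissible_L L"
    and "capacity_on L c"
    and "prokhorov L c"
    and "convex_risk_measure L c \<rho>"
  shows "L1_continuous L c \<rho> \<and>
         (\<forall>g\<in>L1 L c. ereal (\<rho> g) =
            (SUP Q\<in>Pdual L c. ereal (EQ L c Q (\<lambda>x. - g x)) - penalty L c \<rho> Q))"
proof -
  interpret convex_risk L c \<rho>
    using assms separable_metrizable_imp_second_countable by unfold_locales
  have "ereal (\<rho> g) = (SUP Q\<in>Pdual L c. ereal (EQ L c Q (\<lambda>x. - g x)) - penalty L c \<rho> Q)"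
    if g: "g \<in> L1 L c" for g
  proof (rule antisym)
    obtain Q where "Q \<in> Pdual L c" "ereal (\<rho> g) \<le> ereal (EQ L c Q (\<lambda>x. - g x)) - penalty L c \<rho> Q"
      using risk_attained[OF g] by blast
    then show "ereal (\<rho> g) \<le> (SUP Q\<in>Pdual L c. ereal (EQ L c Q (\<lambda>x. - g x)) - penalty L c \<rho> Q)"
      by (rule SUP_upper2)
    show "(SUP Q\<in>Pdual L c. ereal (EQ L c Q (\<lambda>x. - g x)) - penalty L c \<rho> Q) \<le> ereal (\<rho> g)"
      by (intro SUP_least risk_ge g)
  qed
  then show ?thesis using risk_continuous by blast
qed

end
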